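(* Let $T,D,a\in\mathbb{R}$ and let $P:I\to(-\infty,0]$ be the left Poincaré half-map of the system $\dot x=Tx-y$, $\dot y=Dx-a$ associated to $\Sigma=\{x=0\}$. Assume that $a\neq 0$ and $0\in I$. If $P(0)=0$, then $P$ is a real analytic function in $I$, it is an involution (in the sense given in the context), and its Taylor expansion around the origin is $$ \begin{aligned} P(y_0)={}&-y_0-\frac{2T y_0^2}{3a}-\frac{4T^2y_0^3}{9a^2}+\frac{2\left(9DT-22T^3\right)y_0^4}{135a^3}\\ &+\frac{4\left(27DT^2-26T^4\right)y_0^5}{405a^4}-\frac{2\left(27D^2T-176DT^3+100T^5\right)y_0^6}{945a^5}+\mathcal{O}\left(y_0^7\right). \end{aligned} $$
   Context: Let $T,D,a\in\mathbb{R}$ with $a^2+D^2\neq0$ (standing assumption) and consider the planar linear system $\dot x=Tx-y$, $\dot y=Dx-a$, with Poincaré section $\Sigma=\{(x,y)\in\mathbb{R}^2:x=0\}$. Left Poincaré half-map $P$: for $y_0\geqslant0$ let $\Phi(t;y_0)=(\Phi_1(t;y_0),\Phi_2(t;y_0))$ be the solution with $\Phi(0;y_0)=(0,y_0)$. If there exists $\tau(y_0)>0$ such that $\Phi_1(\tau(y_0);y_0)=0$ and $\Phi_1(t;y_0)<0$ for every $t\in(0,\tau(y_0))$, put $P(y_0)=\Phi_2(\tau(y_0);y_0)\leqslant0$. If $P(0)$ is not defined by this rule, but for every $\varepsilon>0$ there exist $y_0\in(0,\varepsilon)$ and $y_1\in(-\varepsilon,0)$ with $P(y_0)=y_1$,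 then $P$ is extended continuously by $P(0)=0$. The domain of $P$ is the interval $I\subset[0,+\infty)$ of all $y_0$ where $P$ is so defined. Put $W(y)=Dy^2-aTy+a^2$. Real analyticity in $I$ at an endpoint belonging to $I$ means that $P$ coincides on $I$ near that point with a function that is real analytic in a neighbourhood of that point. Meaning of "$P$ is an involution" (abuse of language): let $\mathcal{I}$ be the connected component containing $0$ of $\{y\in\mathbb{R}:W(y)>0\}$. Then there is a real analytic function $\varphi_0:\mathcal{I}\to\mathcal{I}$ with $\varphi_0(\varphi_0(y))=y$ for all $y\in\mathcal{I}$, such that $$\left\{(y_1,y_0)\in\mathcal{I}^2:\int_{y_1}^{y_0}\frac{-y}{W(y)}\,dy=0\right\}=\left\{(y_1,y_0)\in\mathcal{I}^2:(y_1-y_0)(y_1-\varphi_0(y_0))=0\right\},$$ and $P$ coincides with the restriction of $\varphi_0$ to $\mathcal{I}\cap[0,+\infty)$. *)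

theory Defs
  imports "HOL-Analysis.Analysis" "HOL-Library.Landau_Symbols"
begin

definition real_analytic_at :: "(real \<Rightarrow> real) \<Rightarrow> real \<Rightarrow> bool" where
  "real_analytic_at f x \<longleftrightarrow> (\<exists>F. (\<lambda>h. f (x + h)) has_fps_expansion F)"

text \<open>
  The set \<open>S\<close> need not be open: at a point of \<open>S\<close>, boundary points included, the function has to
  agree on \<open>S\<close> with one that is analytic in a full neighbourhood of the point.
\<close>
definition real_analytic_on :: "(real \<Rightarrow> real) \<Rightarrow> real set \<Rightarrow> bool" where
  "real_analytic_on f S \<longleftrightarrow>
     (\<forall>x\<in>S. \<exists>U g. open U \<and> x \<in> U \<and> (\<forall>z\<in>U. real_analytic_at g z) \<and> (\<forall>y\<in>S \<inter> U. f y = g y))"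

definition is_solution ::
    "real \<Rightarrow> real \<Rightarrow> real \<Rightarrow> (real \<Rightarrow> real) \<Rightarrow> (real \<Rightarrow> real) \<Rightarrow> bool" where
  "is_solution T D a x y \<longleftrightarrow>
     (\<forall>t. (x has_real_derivative (T * x t - y t)) (at t) \<and>
          (y has_real_derivative (D * x t - a)) (at t))"

definition left_return :: "real \<Rightarrow> real \<Rightarrow> real \<Rightarrow> real \<Rightarrow> real \<Rightarrow> bool" where
  "left_return T D a y0 y1 \<longleftrightarrow>
     y0 \<ge> 0 \<and>
     (\<exists>x y \<tau>. is_solution T D a x y \<and> x 0 = 0 \<and> y 0 = y0 \<and>
        \<tau> > 0 \<and> x \<tau> = 0 \<and> (\<forall>t\<in>{0<..<\<tau>}. x t < 0) \<and> y \<tau> = y1)"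

text \<open>The graph of the left Poincare half-map; the second disjunct is its continuous extension
  to the origin.\<close>
definition half_map_graph :: "real \<Rightarrow> real \<Rightarrow> real \<Rightarrow> real \<Rightarrow> real \<Rightarrow> bool" where
  "half_map_graph T D a y0 y1 \<longleftrightarrow>
     left_return T D a y0 y1 \<or>
     (y0 = 0 \<and> y1 = 0 \<and> (\<nexists>z. left_return T D a 0 z) \<and>
      (\<forall>\<epsilon>>0. \<exists>u\<in>{0<..<\<epsilon>}. \<exists>v\<in>{-\<epsilon><..<0}. left_return T D a u v))"

definition half_map_dom :: "real \<Rightarrow> real \<Rightarrow> real \<Rightarrow> real set" where
  "half_map_dom T D a = {y0. \<exists>y1. half_map_graph T D a y0 y1}"

text \<open>Meaningful on \<open>half_map_dom T D a\<close> only; the value is unique there because the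
  initial value problem has a unique solution.\<close>
definition half_map :: "real \<Rightarrow> real \<Rightarrow> real \<Rightarrow> real \<Rightarrow> real" where
  "half_map T D a y0 = (THE y1. half_map_graph T D a y0 y1)"

definition W :: "real \<Rightarrow> real \<Rightarrow> real \<Rightarrow> real \<Rightarrow> real" where
  "W T D a y = D * y\<^sup>2 - a * T * y + a\<^sup>2"

definition W_component :: "real \<Rightarrow> real \<Rightarrow> real \<Rightarrow> real set" where
  "W_component T D a = connected_component_set {y. W T D a y > 0} 0"

text \<open>The interval integral is oriented, so no order between \<open>y1\<close> and \<open>y0\<close> is presupposed. That the
  half-map is the restriction of \<open>\<phi>\<close> to the nonnegative part of the component includes the equality
  of domains.\<close>
definition half_map_involution :: "real \<Rightarrow> real \<Rightarrow> real \<Rightarrow> bool" where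
  "half_map_involution T D a \<longleftrightarrow>
     (let J = W_component T D a in
      \<exists>\<phi>. \<phi> ` J \<subseteq> J \<and> real_analytic_on \<phi> J \<and> (\<forall>y\<in>J. \<phi> (\<phi> y) = y) \<and>
        {(y1, y0). y1 \<in> J \<and> y0 \<in> J \<and> (LBINT y=ereal y1..ereal y0. - y / W T D a y) = 0} =
        {(y1, y0). y1 \<in> J \<and> y0 \<in> J \<and> (y1 - y0) * (y1 - \<phi> y0) = 0} \<and>
        half_map_dom T D a = J \<inter> {0..} \<and>
        (\<forall>y0\<in>J \<inter> {0..}. half_map T D a y0 = \<phi> y0))"

end

theory Submission
  imports Defs "HOL-Complex_Analysis.Complex_Analysis"
begin

text \<open>
  Let \<open>H y\<close> be the integral of \<open>s / W s\<close> from \<open>0\<close> to \<open>y\<close> on the component \<open>J\<close>. It has a nondegenerate minimum at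
  \<open>0\<close> and tends to infinity at both ends of \<open>J\<close>, so \<open>h y = sgn y * sqrt (H y)\<close> is an analytic
  diffeomorphism from \<open>J\<close> onto the real line and \<open>phi = h\<inverse> \<circ> (- h)\<close> is the analytic involution whose graph,
  together with the diagonal, is the zero set of the integral.

  Along an orbit the velocity \<open>(p, q)\<close> satisfies the linear part of the system, and the slope
  \<open>w = a p / q\<close> solves \<open>w' = - W w / a\<close>. For \<open>a > 0\<close> the coordinate \<open>x\<close> is then a monotone
  function of \<open>H w\<close>, so the orbit returns exactly when \<open>w\<close> reaches \<open>phi y0\<close>. For \<open>a < 0\<close> the
  assumption \<open>P 0 = 0\<close> forces a center with \<open>T = 0\<close>. The Taylor coefficients are read off the
  differential equation obtained from \<open>H (phi t) = H t\<close>.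
\<close>

section \<open>Real functions with local holomorphic extensions\<close>

text \<open>Analyticity is carried by an extension to a small disc because primitives, square roots,
  inverse functions and the splitting of a double zero then come from complex analysis, and only
  values on the real axis remain to be compared. The signed root is forced by the origin:
  \<open>H\<close> has a critical point there, so no inverse function argument applies to
  \<open>H\<close> itself, whereas \<open>h\<close> has a positive derivative on all of
  \<open>J\<close>. The sign of \<open>a\<close> matters because an orbit through the origin has
  \<open>x' = 0\<close> and \<open>x'' = a\<close> there. For \<open>a > 0\<close> it stays in
  \<open>x \<ge> 0\<close> nearby, so \<open>P 0\<close> can only arise as a continuous extension;
  the slope stays finite on every excursion to the left. For \<open>a < 0\<close> the orbit enters
  \<open>x < 0\<close> at once and has to go round the equilibrium. The slope then passes through
  infinity and leaves \<open>J\<close>, so comparing values of \<open>H\<close> along it breaks down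
  and an argument about return times takes its place.\<close>

definition hol_ext :: "(real \<Rightarrow> real) \<Rightarrow> real \<Rightarrow> bool" where
  "hol_ext g x \<longleftrightarrow> (\<exists>f r. r > 0 \<and> f holomorphic_on ball (of_real x) r \<and>
     (\<forall>t. \<bar>t - x\<bar> < r \<longrightarrow> f (of_real t) = of_real (g t)))"

lemma hol_extE:
  assumes "hol_ext g x"
  obtains f r where "r > 0" "f holomorphic_on ball (of_real x) r"
    "\<And>t. \<bar>t - x\<bar> < r \<Longrightarrow> f (of_real t) = of_real (g t)"
  using assms unfolding hol_ext_def by blast

text \<open>Allowing an arbitrary open \<open>A\<close> lets preimages and images of discs serve as
  domains, as composition and inversion require.\<close>

lemma hol_extI:
  assumes "open A" "of_real x \<in> A" "f holomorphic_on A" "e > 0"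
    "\<And>t. \<bar>t - x\<bar> < e \<Longrightarrow> of_real t \<in> A \<Longrightarrow> f (of_real t) = of_real (g t)"
  shows "hol_ext g x"
proof -
  obtain r where r: "r > 0" "ball (of_real x) r \<subseteq> A"
    using assms(1,2) openE by blast
  have "f (of_real t) = of_real (g t)" if "\<bar>t - x\<bar> < min r e" for t
  proof (rule assms(5))
    have "dist (complex_of_real x) (of_real t) < r"
      using that by (simp add: dist_of_real dist_real_def abs_minus_commute)
    then show "of_real t \<in> A" using r by auto
  qed (use that in simp)
  moreover have "f holomorphic_on ball (of_real x) (min r e)"
    using assms(3) by (rule holomorphic_on_subset) (use r in auto)
  ultimately show ?thesis
    unfolding hol_ext_def using r \<open>e > 0\<close> by (intro exI[of _ f] exI[of _ "min r e"]) auto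
qed

text \<open>Taking real parts of the complex Taylor series at real arguments gives a real series for
  \<open>g\<close>, without first showing that the coefficients are real.\<close>

lemma hol_ext_imp_real_analytic_at:
  assumes "hol_ext g x"
  shows "real_analytic_at g x"
proof -
  from assms obtain f r where r: "r > 0" and f: "f holomorphic_on ball (of_real x) r"
    and eq: "\<And>t. \<bar>t - x\<bar> < r \<Longrightarrow> f (of_real t) = of_real (g t)"
    by (rule hol_extE) blast
  define c where "c n = (deriv ^^ n) f (of_real x) / fact n" for n
  have s: "(\<lambda>n. c n * (w - of_real x) ^ n) sums f w" if "w \<in> ball (of_real x) r" for w
    using holomorphic_power_series[OF f that] by (simp add: c_def)
  have "(\<lambda>n. Re (c n) * h ^ n) sums g (x + h)" if "\<bar>h\<bar> < r" for h
  proof -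
    have "(\<lambda>n. c n * of_real (h ^ n)) sums of_real (g (x + h))"
      using s[of "of_real (x + h)"] eq[of "x + h"] that by (simp add: dist_norm)
    from sums_Re[OF this] show ?thesis by simp
  qed
  then have "(\<lambda>h. g (x + h)) has_fps_expansion Abs_fps (\<lambda>n. Re (c n))"
    by (intro has_fps_expansionI) (auto simp: eventually_nhds_metric dist_real_def intro!: exI[of _ r] r)
  then show ?thesis unfolding real_analytic_at_def by blast
qed

text \<open>Both derivatives are limits along the real axis. This transfers a nonzero real
  derivative to the extension, which makes it locally invertible.\<close>

lemma hol_ext_has_derivative:
  assumes "r > 0" "f holomorphic_on ball (of_real x) r"
    and eq: "\<And>t. \<bar>t - x\<bar> < r \<Longrightarrow> f (of_real t) = of_real (g t)"
    and d: "(g has_real_derivative d) (at x)"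
  shows "deriv f (of_real x) = of_real d"
proof -
  have "(f has_field_derivative deriv f (of_real x)) (at (of_real x))"
    using assms(1,2) by (intro holomorphic_derivI) auto
  then have "((\<lambda>t. f (of_real t)) has_vector_derivative deriv f (of_real x)) (at x)"
    by (rule has_vector_derivative_real_field)
  moreover have "((\<lambda>t. f (of_real t)) has_vector_derivative of_real d) (at x)"
  proof (rule has_vector_derivative_transform_within[of "\<lambda>t. of_real (g t)"])
    show "((\<lambda>t. complex_of_real (g t)) has_vector_derivative of_real d) (at x)"
      by (rule has_vector_derivative_of_real) (use d in \<open>simp add: has_real_derivative_iff_has_vector_derivative\<close>)
  qed (use assms(1) eq in \<open>auto simp: dist_real_def\<close>)
  ultimately show ?thesis by (rule vector_derivative_unique_at)
qed

lemma hol_ext_uminus: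
  assumes "hol_ext g x"
  shows "hol_ext (\<lambda>t. - g t) x"
proof -
  from assms obtain f r where "r > 0" "f holomorphic_on ball (of_real x) r"
    "\<And>t. \<bar>t - x\<bar> < r \<Longrightarrow> f (of_real t) = of_real (g t)"
    by (rule hol_extE) blast
  then show ?thesis
    by (intro hol_extI[where A = "ball (of_real x) r" and f = "\<lambda>z. - f z" and e = r])
       (auto intro!: holomorphic_intros)
qed

lemma hol_ext_mult:
  assumes "hol_ext g x" "hol_ext k x"
  shows "hol_ext (\<lambda>t. g t * k t) x"
proof -
  from assms(1) obtain f r where *: "r > 0" "f holomorphic_on ball (of_real x) r"
    "\<And>t. \<bar>t - x\<bar> < r \<Longrightarrow> f (of_real t) = of_real (g t)"
    by (rule hol_extE) blast
  from assms(2) obtain f' r' where **: "r' > 0" "f' holomorphic_on ball (of_real x) r'"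
    "\<And>t. \<bar>t - x\<bar> < r' \<Longrightarrow> f' (of_real t) = of_real (k t)"
    by (rule hol_extE) blast
  show ?thesis
    by (rule hol_extI[where A = "ball (of_real x) (min r r')" and f = "\<lambda>z. f z * f' z" and e = "min r r'"])
       (use * ** in \<open>auto intro!: holomorphic_intros elim: holomorphic_on_subset\<close>)
qed

lemma hol_ext_compose:
  assumes "hol_ext g x" "hol_ext k (g x)"
  shows "hol_ext (\<lambda>t. k (g t)) x"
proof -
  from assms(1) obtain f r where f: "r > 0" "f holomorphic_on ball (of_real x) r"
    "\<And>t. \<bar>t - x\<bar> < r \<Longrightarrow> f (of_real t) = of_real (g t)"
    by (rule hol_extE) blast
  from assms(2) obtain l s where l: "s > 0" "l holomorphic_on ball (of_real (g x)) s"
    "\<And>t. \<bar>t - g x\<bar> < s \<Longrightarrow> l (of_real t) = of_real (k t)"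
    by (rule hol_extE) blast
  define A where "A = ball (of_real x) r \<inter> f -` ball (of_real (g x)) s"
  have fx: "f (of_real x) = of_real (g x)" using f by simp
  have "open A" unfolding A_def
    by (rule continuous_open_preimage[OF holomorphic_on_imp_continuous_on[OF f(2)]]) auto
  moreover have "of_real x \<in> A" using f l fx by (auto simp: A_def)
  moreover have "(\<lambda>z. l (f z)) holomorphic_on A"
    by (rule holomorphic_on_compose_gen[of f A l "ball (of_real (g x)) s", unfolded o_def])
       (use f l in \<open>auto simp: A_def elim: holomorphic_on_subset\<close>)
  moreover have "l (f (of_real t)) = of_real (k (g t))" if "\<bar>t - x\<bar> < r" "of_real t \<in> A" for t
  proof -
    have "f (of_real t) = of_real (g t)" using f that by blast
    moreover have "\<bar>g t - g x\<bar> < s"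
      using that(2) calculation by (simp add: A_def dist_of_real dist_real_def abs_minus_commute)
    ultimately show ?thesis using l by simp
  qed
  ultimately show ?thesis using f(1) by (intro hol_extI[where A = A and f = "\<lambda>z. l (f z)" and e = r])
qed

lemma hol_ext_cong:
  assumes "hol_ext g x" "\<forall>\<^sub>F t in nhds x. g t = k t"
  shows "hol_ext k x"
proof -
  from assms(1) obtain f r where f: "r > 0" "f holomorphic_on ball (of_real x) r"
    "\<And>t. \<bar>t - x\<bar> < r \<Longrightarrow> f (of_real t) = of_real (g t)"
    by (rule hol_extE) blast
  from assms(2) obtain e where "e > 0" "\<And>t. \<bar>t - x\<bar> < e \<Longrightarrow> g t = k t"
    by (auto simp: eventually_nhds_metric dist_real_def)
  then show ?thesis
    using f by (intro hol_extI[where A = "ball (of_real x) r" and f = f and e = "min r e"]) auto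
qed

lemma hol_ext_sqrt:
  assumes "hol_ext g x" "g x > 0"
  shows "hol_ext (\<lambda>t. sqrt (g t)) x"
proof (rule hol_ext_compose[OF assms(1)])
  show "hol_ext sqrt (g x)"
  proof (rule hol_extI[where A = "- \<real>\<^sub>\<le>\<^sub>0" and f = csqrt and e = "g x"])
    show "csqrt holomorphic_on - \<real>\<^sub>\<le>\<^sub>0" by (rule holomorphic_on_csqrt)
    show "complex_of_real (g x) \<in> - \<real>\<^sub>\<le>\<^sub>0" using assms(2) by (simp add: complex_nonpos_Reals_iff)
    show "csqrt (of_real t) = of_real (sqrt t)" if "\<bar>t - g x\<bar> < g x" for t
      by (rule of_real_sqrt[symmetric]) (use that in linarith)
  qed (use assms(2) in \<open>auto intro: open_Compl\<close>)
qed

lemma hol_ext_real_ident: "hol_ext (\<lambda>t. t) x"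
  by (rule hol_extI[where A = UNIV and f = "\<lambda>z. z" and e = 1]) (auto intro: holomorphic_intros)

text \<open>A holomorphic primitive on the disc, shifted to agree with \<open>G\<close> at
  \<open>x\<close>, differs from \<open>G\<close> on the real interval by a function of zero
  derivative.\<close>

lemma holomorphic_primitive_real:
  assumes "r > 0" "f holomorphic_on ball (of_real x) r"
    and eq: "\<And>t. \<bar>t - x\<bar> < r \<Longrightarrow> f (of_real t) = of_real (g t)"
    and d: "\<And>t. \<bar>t - x\<bar> < r \<Longrightarrow> (G has_real_derivative g t) (at t)"
  obtains F where "\<And>z. z \<in> ball (of_real x) r \<Longrightarrow> (F has_field_derivative f z) (at z)"
    "\<And>t. \<bar>t - x\<bar> < r \<Longrightarrow> F (of_real t) = of_real (G t)"
proof -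
  obtain F0 where F0: "\<And>z. z \<in> ball (of_real x) r \<Longrightarrow> (F0 has_field_derivative f z) (at z within ball (of_real x) r)"
    using holomorphic_convex_primitive'[OF _ _ assms(2)] by auto
  define F where "F z = F0 z - F0 (of_real x) + of_real (G x)" for z
  have F: "(F has_field_derivative f z) (at z)" if "z \<in> ball (of_real x) r" for z
    unfolding F_def using F0[OF that] that at_within_open[of z "ball (of_real x) r"]
    by (auto intro!: derivative_eq_intros)
  have "F (of_real t) = of_real (G t)" if t: "\<bar>t - x\<bar> < r" for t
  proof -
    define S where "S = {x - r<..<x + r}"
    have "((\<lambda>t. F (of_real t) - of_real (G t)) has_vector_derivative 0) (at s within S)" if "s \<in> S" for s
    proof -
      have s: "\<bar>s - x\<bar> < r" using that by (auto simp: S_def)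
      have "((\<lambda>t. F (of_real t)) has_vector_derivative f (of_real s)) (at s within S)"
        by (rule has_vector_derivative_at_within, rule has_vector_derivative_real_field, rule F)
           (use s in \<open>auto simp: dist_real_def abs_minus_commute\<close>)
      moreover have "((\<lambda>t. complex_of_real (G t)) has_vector_derivative of_real (g s)) (at s within S)"
        by (rule has_vector_derivative_at_within, rule has_vector_derivative_of_real)
           (use d[OF s] in \<open>simp add: has_real_derivative_iff_has_vector_derivative\<close>)
      ultimately show ?thesis
        using has_vector_derivative_diff[of "\<lambda>t. F (of_real t)" "f (of_real s)" "at s within S" "\<lambda>t. of_real (G t)" "of_real (g s)"] eq[OF s] by simp
    qed
    then obtain c where c: "\<And>s. s \<in> S \<Longrightarrow> F (of_real s) - of_real (G s) = c"
      using has_vector_derivative_zero_constant[of S "\<lambda>t. F (of_real t) - of_real (G t)"]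
      by (auto simp: S_def)
    have "c = 0" using c[of x] assms(1) by (simp add: S_def F_def)
    moreover have "t \<in> S" using t unfolding S_def by simp linarith
    ultimately show ?thesis using c[of t] by simp
  qed
  with F show ?thesis using that by blast
qed

lemma hol_ext_primitive:
  assumes "hol_ext g x" "e > 0" "\<And>t. \<bar>t - x\<bar> < e \<Longrightarrow> (G has_real_derivative g t) (at t)"
  shows "hol_ext G x"
proof -
  from assms(1) obtain f r where f: "r > 0" "f holomorphic_on ball (of_real x) r"
    "\<And>t. \<bar>t - x\<bar> < r \<Longrightarrow> f (of_real t) = of_real (g t)"
    by (rule hol_extE) blast
  have "f holomorphic_on ball (of_real x) (min r e)"
    using f(2) by (rule holomorphic_on_subset) auto
  then obtain F where F: "\<And>z. z \<in> ball (of_real x) (min r e) \<Longrightarrow> (F has_field_derivative f z) (at z)"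
    "\<And>t. \<bar>t - x\<bar> < min r e \<Longrightarrow> F (of_real t) = of_real (G t)"
    using holomorphic_primitive_real[of "min r e" f x g G] f assms(2,3) by auto
  show ?thesis
  proof (rule hol_extI[where A = "ball (of_real x) (min r e)" and f = F and e = "min r e"])
    show "F holomorphic_on ball (complex_of_real x) (min r e)"
      using F(1) holomorphic_on_open by blast
  qed (use f(1) assms(2) F in auto)
qed

text \<open>The local holomorphic inverse \<open>K\<close> of the extension extends
  \<open>k\<close>: continuity of \<open>k\<close> puts \<open>k u\<close> into the disc on which
  the extension is injective, and there \<open>K\<close> must return it.\<close>

lemma hol_ext_inverse_function:
  assumes "hol_ext g x" "(g has_real_derivative d) (at x)" "d \<noteq> 0"
    and k: "isCont k (g x)" "k (g x) = x" "\<And>u. g (k u) = u"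
  shows "hol_ext k (g x)"
proof -
  from assms(1) obtain f r where f: "r > 0" "f holomorphic_on ball (of_real x) r"
    "\<And>t. \<bar>t - x\<bar> < r \<Longrightarrow> f (of_real t) = of_real (g t)"
    by (rule hol_extE) blast
  have "deriv f (of_real x) \<noteq> 0"
    using hol_ext_has_derivative[OF f assms(2)] assms(3) by simp
  then obtain s where s: "s > 0" "ball (complex_of_real x) s \<subseteq> ball (of_real x) r"
    "open (f ` ball (of_real x) s)" "inj_on f (ball (of_real x) s)"
    using has_complex_derivative_locally_invertible[OF f(2) centre_in_ball[THEN iffD2, OF f(1)] open_ball] by metis
  obtain K where K: "K holomorphic_on (f ` ball (of_real x) s)"
    "\<And>z. z \<in> ball (of_real x) s \<Longrightarrow> K (f z) = z"
    using holomorphic_has_inverse[OF holomorphic_on_subset[OF f(2) s(2)] open_ball s(4)] by metis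
  obtain e where e: "e > 0" "\<And>u. \<bar>u - g x\<bar> < e \<Longrightarrow> \<bar>k u - x\<bar> < s"
    using k(1) s(1) unfolding continuous_at_eps_delta k(2) by (auto simp: dist_real_def)
  have fx: "f (of_real x) = of_real (g x)" using f by simp
  show ?thesis
  proof (rule hol_extI[OF s(3) _ K(1) e(1)])
    show "of_real (g x) \<in> f ` ball (of_real x) s"
      using s(1) fx by (metis centre_in_ball imageI)
  next
    fix u assume u: "\<bar>u - g x\<bar> < e"
    have m: "of_real (k u) \<in> ball (complex_of_real x) s"
      using e(2)[OF u] by (simp add: dist_of_real dist_real_def abs_minus_commute)
    then have "complex_of_real (k u) \<in> ball (of_real x) r" using s(2) by blast
    then have "\<bar>k u - x\<bar> < r" by (simp add: dist_of_real dist_real_def abs_minus_commute)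
    then have "f (of_real (k u)) = of_real u" using f(3) k(3) by simp
    then show "K (of_real u) = of_real (k u)" using K(2)[OF m] by simp
  qed
qed

text \<open>The primitive of \<open>t * w t\<close> has a zero of order exactly two at
  \<open>0\<close>. Splitting off \<open>t^2\<close> leaves a positive analytic factor, so that
  \<open>t * sqrt (q t)\<close> is an analytic signed root of \<open>G\<close>.\<close>

lemma hol_ext_square_factor:
  assumes w: "hol_ext w 0" "w 0 > 0" and "e > 0"
    and d: "\<And>t. \<bar>t\<bar> < e \<Longrightarrow> (G has_real_derivative t * w t) (at t)" and "G 0 = 0"
    and pos: "\<And>t. \<bar>t\<bar> < e \<Longrightarrow> t \<noteq> 0 \<Longrightarrow> G t > 0"
  obtains q where "hol_ext q 0" "q 0 > 0" "\<forall>\<^sub>F t in nhds 0. G t = t\<^sup>2 * q t"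
proof -
  from w(1) obtain f0 r0 where f0: "r0 > 0" "f0 holomorphic_on ball 0 r0"
    "\<And>t. \<bar>t\<bar> < r0 \<Longrightarrow> f0 (of_real t) = of_real (w t)"
    by (rule hol_extE) auto
  define r where "r = min r0 e"
  have r: "r > 0" using f0 \<open>e > 0\<close> by (simp add: r_def)
  have holf0: "f0 holomorphic_on ball 0 r"
    by (rule holomorphic_on_subset[OF f0(2)]) (auto simp: r_def)
  have holf: "(\<lambda>z. z * f0 z) holomorphic_on ball 0 r"
    by (intro holomorphic_intros holf0)
  obtain F where F: "\<And>z. z \<in> ball 0 r \<Longrightarrow> (F has_field_derivative z * f0 z) (at z)"
    "\<And>t. \<bar>t\<bar> < r \<Longrightarrow> F (of_real t) = of_real (G t)"
    using holomorphic_primitive_real[of r "\<lambda>z. z * f0 z" 0 "\<lambda>t. t * w t" G] r holf f0(3) d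
    by (auto simp: r_def)
  have dF: "deriv F z = z * f0 z" if "z \<in> ball 0 r" for z
    using F(1)[OF that] by (rule DERIV_imp_deriv)
  have "((\<lambda>z. z * f0 z) has_field_derivative f0 0) (at 0)"
    using holomorphic_derivI[OF holf0, of 0] r by (auto intro!: derivative_eq_intros)
  then have "deriv (\<lambda>z. z * f0 z) 0 = f0 0" by (rule DERIV_imp_deriv)
  moreover have "deriv (deriv F) 0 = deriv (\<lambda>z. z * f0 z) 0"
    by (rule deriv_cong_ev) (use r dF in \<open>auto simp: eventually_nhds_metric intro!: exI[of _ r]\<close>)
  \<comment> \<open>The second derivative of \<open>F\<close> at \<open>0\<close> equals
    \<open>w 0\<close>, which is positive.\<close>
  ultimately have d2: "(deriv ^^ 2) F 0 \<noteq> 0"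
    using f0(3)[of 0] f0(1) w(2) by (simp add: numeral_2_eq_2)
  have "F holomorphic_on ball 0 r"
    using F(1) holomorphic_on_open by blast
  then obtain g s where g: "0 < s" "g holomorphic_on ball 0 s"
    "\<And>z. z \<in> ball 0 s \<Longrightarrow> F z - F 0 = (z - 0)^2 * g z" "\<And>z. z \<in> ball 0 s \<Longrightarrow> g z \<noteq> 0"
  proof (rule holomorphic_factor_order_of_zero)
    show "(deriv ^^ i) F 0 = 0" if "0 < i" "i < 2" for i
    proof -
      have "i = 1" using that by simp
      then show ?thesis using dF[of 0] r by simp
    qed
  qed (use r d2 in auto)
  define q where "q t = Re (g (of_real t))" for t
  have G: "of_real (G t) = (of_real t)^2 * g (of_real t)" if "\<bar>t\<bar> < min r s" for t
    using g(3)[of "of_real t"] F(2)[of t] F(2)[of 0] that r \<open>G 0 = 0\<close> by simp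
  have geq: "g (of_real t) = of_real (G t / t\<^sup>2)" if "\<bar>t\<bar> < min r s" "t \<noteq> 0" for t
    using G[OF that(1)] that(2) by (simp add: field_simps)
  have contg: "isCont g 0"
    using g(1,2) by (meson centre_in_ball continuous_on_eq_continuous_at holomorphic_on_imp_continuous_on open_ball)
  have tl: "((\<lambda>t. g (of_real t)) \<longlongrightarrow> g 0) (at (0::real))"
    by (rule isCont_tendsto_compose[OF contg]) (auto intro!: tendsto_eq_intros)
  have near: "\<forall>\<^sub>F t in at (0::real). \<bar>t\<bar> < min r s \<and> t \<noteq> 0"
    unfolding eventually_at using r g(1) by (intro exI[of _ "min r s"]) auto
  \<comment> \<open>Off \<open>0\<close> the factor is the real quotient \<open>G t / t^2\<close>;
    at \<open>0\<close> its being real is a limit statement.\<close>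
  have "Im (g 0) = 0"
  proof (rule tendsto_unique[OF _ tendsto_Im[OF tl]])
    show "((\<lambda>t. Im (g (of_real t))) \<longlongrightarrow> 0) (at (0::real))"
      by (rule tendsto_eventually, rule eventually_mono[OF near]) (auto simp: geq)
  qed simp
  \<comment> \<open>The limit yields only a weak inequality; it becomes strict because
    \<open>g 0\<close> is real and nonzero.\<close>
  have "Re (g 0) \<ge> 0"
  proof (rule tendsto_lowerbound[OF tendsto_Re[OF tl]])
    show "\<forall>\<^sub>F t in at (0::real). 0 \<le> Re (g (of_real t))"
    proof (rule eventually_mono[OF near])
      fix t :: real assume t: "\<bar>t\<bar> < min r s \<and> t \<noteq> 0"
      then have "G t > 0" using pos by (simp add: r_def)
      then show "0 \<le> Re (g (of_real t))" using geq t by simp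
    qed
  qed simp
  with \<open>Im (g 0) = 0\<close> have "q 0 > 0"
    using g(4)[of 0] g(1) by (auto simp: q_def complex_eq_iff)
  have real: "g (of_real t) = of_real (q t)" if "\<bar>t\<bar> < min r s" for t
  proof (cases "t = 0")
    case True
    then show ?thesis using \<open>Im (g 0) = 0\<close> by (simp add: q_def complex_eq_iff)
  next
    case False
    then show ?thesis using geq[OF that] by (simp add: q_def)
  qed
  have "hol_ext q 0"
    by (rule hol_extI[where A = "ball 0 s" and f = g and e = "min r s"]) (use g r real in auto)
  moreover have "\<forall>\<^sub>F t in nhds 0. G t = t\<^sup>2 * q t"
    unfolding eventually_nhds_metric
  proof (intro exI[of _ "min r s"] conjI allI impI)
    fix t :: real assume "dist t 0 < min r s"
    then have t: "\<bar>t\<bar> < min r s" by simp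
    have "complex_of_real (G t) = of_real (t\<^sup>2 * q t)"
      using G[OF t] real[OF t] by simp
    then show "G t = t\<^sup>2 * q t" using of_real_eq_iff by blast
  qed (use r g in auto)
  ultimately show ?thesis using \<open>q 0 > 0\<close> that by blast
qed

section \<open>The involution\<close>

text \<open>Connected subsets of the line are convex. The closed segment covers both signs of
  \<open>y\<close> at once.\<close>

lemma mem_W_component_iff:
  "y \<in> W_component T D a \<longleftrightarrow> (\<forall>s\<in>closed_segment 0 y. W T D a s > 0)"
proof
  assume y: "y \<in> W_component T D a"
  then have "0 \<in> W_component T D a"
    unfolding W_component_def by (metis connected_component_in connected_component_refl mem_Collect_eq)
  moreover have "convex (W_component T D a)"
    unfolding W_component_def by (metis connected_connected_component is_interval_connected_1 is_interval_convex_1)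
  ultimately have "closed_segment 0 y \<subseteq> W_component T D a"
    using y by (simp add: closed_segment_subset)
  also have "\<dots> \<subseteq> {y. W T D a y > 0}"
    unfolding W_component_def by (rule connected_component_subset)
  finally show "\<forall>s\<in>closed_segment 0 y. W T D a s > 0" by blast
next
  assume "\<forall>s\<in>closed_segment 0 y. W T D a s > 0"
  then have "closed_segment 0 y \<subseteq> connected_component_set {y. W T D a y > 0} 0"
    by (intro connected_component_maximal) (auto simp: convex_connected)
  then show "y \<in> W_component T D a"
    unfolding W_component_def by auto
qed

lemma W_has_derivative: "(W T D a has_real_derivative 2 * D * y - a * T) (at y)"
  unfolding W_def[abs_def] by (auto intro!: derivative_eq_intros)

lemma isCont_W: "isCont (W T D a) y"
  using W_has_derivative by (rule DERIV_isCont)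

lemma continuous_on_W: "continuous_on S (W T D a)"
  by (simp add: continuous_at_imp_continuous_on isCont_W)

text \<open>Reflecting \<open>y\<close> amounts to reversing the sign of \<open>T\<close>;
  statements about the right end of the component thereby apply to the left end.\<close>

lemma W_uminus: "W T D a (- y) = W (- T) D a y"
  by (simp add: W_def)

lemma mem_W_component_uminus: "- y \<in> W_component T D a \<longleftrightarrow> y \<in> W_component (- T) D a"
proof -
  have "closed_segment 0 (- y) = uminus ` closed_segment 0 y"
    by (auto simp: closed_segment_eq_real_ivl)
  then show ?thesis by (simp add: mem_W_component_iff W_uminus)
qed

text \<open>At an infinite end of the component \<open>W\<close> grows at most quadratically, and at a finite end \<open>W\<close>
  vanishes at least linearly: in both cases the integral of \<open>y / W\<close> diverges at least logarithmically.\<close>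

lemma W_primitive_unbounded:
  fixes G :: "real \<Rightarrow> real"
  assumes a: "a \<noteq> 0"
    and G: "\<And>y. y \<in> W_component T D a \<Longrightarrow> 0 \<le> y \<Longrightarrow> (G has_real_derivative y / W T D a y) (at y)"
  shows "\<exists>y\<in>W_component T D a. y > 0 \<and> G y > M"
proof (cases "\<exists>s\<ge>0. W T D a s \<le> 0")
  case False
  then have pos: "W T D a s > 0" if "s \<ge> 0" for s using that by force
  then have J: "y \<in> W_component T D a" if "y \<ge> 0" for y
    using that by (auto simp: mem_W_component_iff closed_segment_eq_real_ivl)
  \<comment> \<open>For \<open>s \<ge> 1\<close> all three monomials of \<open>W\<close> are at most
    their absolute coefficient times \<open>s^2\<close>, so \<open>s / W\<close> is at least
    \<open>1 / (C * s)\<close>.\<close>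
  define C where "C = \<bar>D\<bar> + \<bar>a * T\<bar> + a\<^sup>2"
  have C: "C > 0" using a by (simp add: C_def add_nonneg_pos)
  have le: "W T D a s \<le> C * s\<^sup>2" if "s \<ge> 1" for s
  proof -
    have s2: "s \<le> s\<^sup>2" "1 \<le> s\<^sup>2" using that self_le_power[of s 2] one_le_power[of s 2] by simp_all
    have "D * s\<^sup>2 \<le> \<bar>D\<bar> * s\<^sup>2" by (simp add: mult_right_mono)
    moreover have "- (a * T) * s \<le> \<bar>a * T\<bar> * s\<^sup>2"
      by (rule mult_mono) (use s2 that in auto)
    moreover have "a\<^sup>2 * 1 \<le> a\<^sup>2 * s\<^sup>2" using s2 by (intro mult_left_mono) auto
    ultimately show ?thesis unfolding W_def C_def by (simp add: algebra_simps)
  qed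
  \<comment> \<open>Chosen so that the logarithmic lower bound \<open>ln y / C\<close> exceeds
    \<open>M - G 1\<close>.\<close>
  define y where "y = exp (C * (\<bar>M - G 1\<bar> + 1))"
  have y: "y \<ge> 1" using C by (simp add: y_def)
  have "G 1 - ln 1 / C \<le> G y - ln y / C"
  proof (rule DERIV_nonneg_imp_nondecreasing[OF y])
    fix s :: real assume s: "1 \<le> s" "s \<le> y"
    have "((\<lambda>s. G s - ln s / C) has_real_derivative s / W T D a s - 1 / (s * C)) (at s)"
      using s C by (auto intro!: derivative_eq_intros G J)
    moreover have "s / W T D a s - 1 / (s * C) \<ge> 0"
      using le[of s] pos[of s] s C by (simp add: field_simps power2_eq_square)
    ultimately show "\<exists>d. ((\<lambda>s. G s - ln s / C) has_real_derivative d) (at s) \<and> 0 \<le> d" by blast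
  qed
  moreover have "ln y / C = \<bar>M - G 1\<bar> + 1" using C by (simp add: y_def)
  ultimately have "G y > M" by simp
  with y J show ?thesis by (intro bexI[of _ y]) auto
next
  case True
  \<comment> \<open>The infimum \<open>r\<close> of \<open>Z\<close> is the first point to the right
    of \<open>0\<close> where \<open>W\<close> stops being positive, that is, the right end of the
    component.\<close>
  define Z where "Z = {s. 0 \<le> s \<and> W T D a s \<le> 0}"
  define r where "r = Inf Z"
  have Z: "closed Z" "Z \<noteq> {}" "bdd_below Z"
  proof -
    show "closed Z" unfolding Z_def
      by (intro closed_Collect_conj closed_Collect_le continuous_on_W continuous_intros)
    show "bdd_below Z" unfolding Z_def by (rule bdd_belowI[of _ 0]) auto
  qed (use True in \<open>auto simp: Z_def\<close>)
  have "r \<in> Z" unfolding r_def using Z by (intro closed_contains_Inf)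
  moreover have "W T D a 0 > 0" using a by (simp add: W_def)
  ultimately have r: "r > 0" "W T D a r \<le> 0" by (auto simp: Z_def order_less_le)
  have pos: "W T D a s > 0" if "0 \<le> s" "s < r" for s
  proof (rule ccontr)
    assume "\<not> W T D a s > 0"
    then have "s \<in> Z" using that by (simp add: Z_def)
    then have "r \<le> s" unfolding r_def using Z by (intro cInf_lower)
    with that show False by simp
  qed
  then have J: "y \<in> W_component T D a" if "0 \<le> y" "y < r" for y
    using that by (auto simp: mem_W_component_iff closed_segment_eq_real_ivl)
  \<comment> \<open>A bound for the factor left after dividing \<open>W s - W r\<close> by
    \<open>r - s\<close>; the summand \<open>1\<close> makes it positive.\<close>
  define C where "C = 2 * r * \<bar>D\<bar> + \<bar>a * T\<bar> + 1"
  have C: "C > 0" using r by (simp add: C_def add_nonneg_pos)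
  have le: "W T D a s \<le> C * (r - s)" if "0 \<le> s" "s < r" for s
  proof -
    have "W T D a s \<le> W T D a s - W T D a r" using r by simp
    also have "\<dots> = (a * T - D * (s + r)) * (r - s)"
      by (simp add: W_def power2_eq_square algebra_simps)
    also have "\<dots> \<le> C * (r - s)"
    proof (rule mult_right_mono)
      have "- D * (s + r) \<le> \<bar>D\<bar> * (2 * r)" by (rule mult_mono) (use that r in auto)
      then show "a * T - D * (s + r) \<le> C" unfolding C_def by (simp add: algebra_simps)
    qed (use that in simp)
    finally show ?thesis .
  qed
  \<comment> \<open>On \<open>[r / 2, r)\<close> the numerator \<open>s\<close> is at least
    \<open>r / 2\<close>, so the integrand dominates \<open>r / (2 * C)\<close> times
    \<open>1 / (r - s)\<close>. Moving from \<open>r / 2\<close> to \<open>y\<close> lowers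
    \<open>ln (r - s)\<close> by exactly \<open>K\<close>, a gain of
    \<open>\<bar>M - G (r / 2)\<bar> + 1\<close>.\<close>
  define K where "K = 2 * C / r * (\<bar>M - G (r / 2)\<bar> + 1)"
  have K: "K \<ge> 0" using r C by (simp add: K_def)
  define y where "y = r - (r / 2) * exp (- K)"
  have "exp (- K) \<le> 1" using K by simp
  then have "(r / 2) * exp (- K) \<le> r / 2 * 1" using r by (intro mult_left_mono) auto
  then have y: "r / 2 \<le> y" "y < r" using r by (simp_all add: y_def)
  have "G (r / 2) + r / (2 * C) * ln (r - r / 2) \<le> G y + r / (2 * C) * ln (r - y)"
  proof (rule DERIV_nonneg_imp_nondecreasing[OF y(1)])
    fix s :: real assume s: "r / 2 \<le> s" "s \<le> y"
    have s': "0 \<le> s" "s < r" using s y r by auto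
    have "((\<lambda>s. G s + r / (2 * C) * ln (r - s)) has_real_derivative
        s / W T D a s + r / (2 * C) * (- 1 / (r - s))) (at s)"
      using s' C by (auto intro!: derivative_eq_intros G J)
    moreover have "r / (2 * C) * (1 / (r - s)) \<le> s / W T D a s"
    proof -
      have "r / (2 * C) * (1 / (r - s)) = (r / 2) / (C * (r - s))" by simp
      also have "\<dots> \<le> s / W T D a s"
        using le[OF s'] pos[OF s'] s s' r by (intro frac_le) auto
      finally show ?thesis .
    qed
    ultimately show "\<exists>d. ((\<lambda>s. G s + r / (2 * C) * ln (r - s)) has_real_derivative d) (at s) \<and> 0 \<le> d"
      by (intro exI[of _ "s / W T D a s + r / (2 * C) * (- 1 / (r - s))"]) auto
  qed
  moreover have "ln (r - y) = ln (r / 2) - K"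
  proof -
    have "ln (r - y) = ln (r / 2 * exp (- K))" by (simp add: y_def)
    also have "\<dots> = ln (r / 2) + ln (exp (- K))" using r by (intro ln_mult_pos) auto
    finally show ?thesis by simp
  qed
  moreover have "r / (2 * C) * (ln (r / 2) - K) = r / (2 * C) * ln (r / 2) - (\<bar>M - G (r / 2)\<bar> + 1)"
    using r C by (simp add: K_def right_diff_distrib)
  ultimately have "G y > M" by simp
  with y r J show ?thesis by (intro bexI[of _ y]) auto
qed

section \<open>The integral \<open>H\<close>, its signed root and the involution
  \<open>phi\<close>\<close>

locale half_map_params =
  fixes T D a :: real
  assumes a_nonzero: "a \<noteq> 0"
begin

abbreviation "J \<equiv> W_component T D a"

definition H :: "real \<Rightarrow> real" where
  "H y = (LBINT s=ereal 0..ereal y. s / W T D a s)"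

lemma open_J: "open J"
proof -
  have "open {y. 0 < W T D a y}"
    by (intro open_Collect_less continuous_on_W continuous_intros)
  then show ?thesis unfolding W_component_def by (rule open_connected_component)
qed

lemma convex_J: "convex J"
  unfolding W_component_def by (metis connected_connected_component is_interval_connected_1 is_interval_convex_1)

lemma interval_subset_J:
  assumes "u \<in> J" "v \<in> J"
  shows "{u..v} \<subseteq> J"
  using closed_segment_subset[OF assms convex_J]
  by (cases "u \<le> v") (simp_all add: closed_segment_eq_real_ivl)

lemma W_pos: "y \<in> J \<Longrightarrow> W T D a y > 0"
  by (auto simp: mem_W_component_iff)

lemma zero_in_J: "0 \<in> J"
  using a_nonzero by (simp add: mem_W_component_iff W_def)

lemma integral_from_0_has_derivative:
  assumes "continuous_on J f" "y \<in> J"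
  shows "((\<lambda>y. LBINT s=ereal 0..ereal y. f s) has_real_derivative f y) (at y)"
proof -
  obtain e where e: "e > 0" "ball y e \<subseteq> J" using open_J assms(2) openE by blast
  obtain e' where e': "e' > 0" "ball 0 e' \<subseteq> J" using open_J zero_in_J openE by blast
  \<comment> \<open>The margin \<open>d\<close> puts \<open>y\<close> into the interior of an
    interval containing \<open>0\<close>, which turns the derivative within the interval into a
    two-sided one.\<close>
  define d where "d = min e e' / 2"
  have d: "d > 0" using e e' by (simp add: d_def)
  have "y - d \<in> J" "y + d \<in> J" "- d \<in> J" "d \<in> J"
    using e e' by (auto simp: d_def dist_real_def subset_iff)
  then have in_J: "min 0 y - d \<in> J" "max 0 y + d \<in> J"
    by (auto simp: min_def max_def)
  define l where "l = min 0 y - d"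
  define u where "u = max 0 y + d"
  have sub: "{l..u} \<subseteq> J" using in_J interval_subset_J by (simp add: l_def u_def)
  have "continuous_on {l..u} f"
    using assms(1) sub by (rule continuous_on_subset)
  then have "((\<lambda>x. LBINT s=ereal 0..ereal x. f s) has_vector_derivative f y) (at y within {l..u})"
    by (intro interval_integral_FTC2) (use d in \<open>auto simp: l_def u_def\<close>)
  moreover have "y \<in> interior {l..u}"
    using d by (auto simp: l_def u_def interior_atLeastAtMost_real)
  ultimately show ?thesis
    unfolding has_real_derivative_iff_has_vector_derivative
    by (simp only: at_within_interior)
qed

lemma continuous_on_div_W:
  assumes "continuous_on J f"
  shows "continuous_on J (\<lambda>s. f s / W T D a s)"
  by (intro continuous_intros assms continuous_on_W) (use W_pos in force)

lemma H_has_derivative: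
  assumes "y \<in> J"
  shows "(H has_real_derivative y / W T D a y) (at y)"
  unfolding H_def[abs_def]
  by (intro integral_from_0_has_derivative continuous_on_div_W continuous_intros assms)

lemma interval_integral_eq_H_diff:
  assumes "u \<in> J" "v \<in> J"
  shows "(LBINT y=ereal u..ereal v. - y / W T D a y) = H u - H v"
proof -
  have sub: "{min u v..max u v} \<subseteq> J"
    using assms interval_subset_J[of u v] interval_subset_J[of v u] by (cases "u \<le> v") simp_all
  have "(LBINT y=ereal u..ereal v. - y / W T D a y) = - H v - - H u"
  proof (rule interval_integral_FTC_finite)
    show "continuous_on {min u v..max u v} (\<lambda>y. - y / W T D a y)"
      by (intro continuous_intros continuous_on_W) (use sub W_pos in force)
    fix y assume "min u v \<le> y" "y \<le> max u v"
    then have "y \<in> J" using sub by auto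
    from DERIV_minus[OF H_has_derivative[OF this]]
    show "((\<lambda>y. - H y) has_vector_derivative - y / W T D a y) (at y within {min u v..max u v})"
      by (simp add: has_real_derivative_iff_has_vector_derivative has_vector_derivative_at_within)
  qed
  then show ?thesis by simp
qed

lemma H_0 [simp]: "H 0 = 0"
  by (simp add: H_def)

lemma H_pos:
  assumes "y \<in> J" "y \<noteq> 0"
  shows "H y > 0"
proof (cases "y > 0")
  case True
  have sub: "{0..y} \<subseteq> J" using interval_subset_J zero_in_J assms by blast
  then have "(H has_real_derivative s / W T D a s) (at s)" if "0 \<le> s" "s \<le> y" for s
    using that by (intro H_has_derivative) auto
  then obtain z where "0 < z" "z < y" "H y - H 0 = (y - 0) * (z / W T D a z)"
    using MVT2[OF True, of H "\<lambda>s. s / W T D a s"] by blast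
  moreover from this have "z \<in> J" using sub by auto
  then have "y * z / W T D a z > 0"
    using True \<open>0 < z\<close> W_pos[of z] by (intro divide_pos_pos mult_pos_pos) auto
  ultimately show ?thesis by simp
next
  case False
  then have y: "y < 0" using assms by simp
  have sub: "{y..0} \<subseteq> J" using interval_subset_J zero_in_J assms by blast
  then have "(H has_real_derivative s / W T D a s) (at s)" if "y \<le> s" "s \<le> 0" for s
    using that by (intro H_has_derivative) auto
  then obtain z where "y < z" "z < 0" "H 0 - H y = (0 - y) * (z / W T D a z)"
    using MVT2[OF y, of H "\<lambda>s. s / W T D a s"] by blast
  moreover from this have "z \<in> J" using sub by auto
  then have "y * z / W T D a z > 0"
    using y \<open>z < 0\<close> W_pos[of z] sub by (intro divide_pos_pos mult_neg_neg) auto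
  ultimately show ?thesis by simp
qed

lemma H_nonneg: "y \<in> J \<Longrightarrow> H y \<ge> 0"
  using H_pos by (cases "y = 0") (auto intro: less_imp_le)

definition h :: "real \<Rightarrow> real" where
  "h y = sgn y * sqrt (H y)"

lemma h_0 [simp]: "h 0 = 0"
  by (simp add: h_def)

lemma h_squared: "y \<in> J \<Longrightarrow> (h y)\<^sup>2 = H y"
  using H_nonneg by (cases "y = 0") (auto simp: h_def power_mult_distrib sgn_if)

lemma hol_ext_inverse_W:
  assumes "W T D a x \<noteq> 0"
  shows "hol_ext (\<lambda>y. 1 / W T D a y) x"
proof -
  define f where "f z = complex_of_real D * z\<^sup>2 - of_real (a * T) * z + of_real (a\<^sup>2)" for z
  have f: "f (of_real y) = of_real (W T D a y)" for y by (simp add: f_def W_def)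
  have "f holomorphic_on UNIV" unfolding f_def by (intro holomorphic_intros)
  moreover from this have "open (- f -` {0})"
    by (intro open_Compl continuous_closed_vimage) (auto dest!: holomorphic_on_imp_continuous_on simp: continuous_on_eq_continuous_at)
  ultimately show ?thesis
    by (intro hol_extI[where A = "- f -` {0}" and f = "\<lambda>z. 1 / f z" and e = 1])
       (use assms in \<open>auto simp: f intro!: holomorphic_intros elim: holomorphic_on_subset\<close>)
qed

text \<open>Away from \<open>0\<close> the function is, up to sign, the root of a positive analytic
  primitive. At \<open>0\<close> the factor \<open>t^2\<close> of \<open>H\<close> is extracted
  first, and its signed root is \<open>t\<close>.\<close>

lemma h_local:
  assumes "y \<in> J"
  shows "hol_ext h y" "\<exists>d>0. (h has_real_derivative d) (at y)"
proof -
  obtain e where e: "e > 0" "ball y e \<subseteq> J" using open_J assms openE by blast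
  have inJ: "t \<in> J" if "\<bar>t - y\<bar> < e" for t
    using e that by (auto simp: dist_real_def subset_iff abs_minus_commute)
  have Wy: "W T D a y > 0" using W_pos assms by blast
  have inv: "hol_ext (\<lambda>y. 1 / W T D a y) y" using Wy by (intro hol_ext_inverse_W) simp
  have "hol_ext h y \<and> (\<exists>d>0. (h has_real_derivative d) (at y))"
  proof (cases "y = 0")
    case True
    obtain q where q: "hol_ext q 0" "q 0 > 0" "\<forall>\<^sub>F t in nhds 0. H t = t\<^sup>2 * q t"
    proof (rule hol_ext_square_factor[of "\<lambda>y. 1 / W T D a y" e H])
      show "(H has_real_derivative t * (1 / W T D a t)) (at t)" if "\<bar>t\<bar> < e" for t
        using H_has_derivative[OF inJ] that True by simp
    qed (use inv True Wy e inJ H_pos in auto)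
    have sq: "hol_ext (\<lambda>t. sqrt (q t)) 0" using q by (intro hol_ext_sqrt)
    have ev: "\<forall>\<^sub>F t in nhds 0. t * sqrt (q t) = h t"
      using q(3) by (rule eventually_mono) (auto simp: h_def real_sqrt_mult sgn_if)
    have "hol_ext (\<lambda>t. t * sqrt (q t)) 0" by (rule hol_ext_mult[OF hol_ext_real_ident sq])
    then have "hol_ext h y" using ev True by (auto intro: hol_ext_cong)
    \<comment> \<open>The difference quotient of \<open>t * sqrt (q t)\<close> at \<open>0\<close>
      is \<open>sqrt (q t)\<close>, so continuity of the latter gives the derivative.\<close>
    moreover have "(h has_real_derivative sqrt (q 0)) (at 0)"
    proof -
      from sq obtain f r where f: "r > 0" "f holomorphic_on ball (of_real 0) r"
        "\<And>t. \<bar>t - 0\<bar> < r \<Longrightarrow> f (of_real t) = of_real (sqrt (q t))"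
        by (rule hol_extE) blast
      have "isCont f 0"
        using f(1,2) by (metis centre_in_ball continuous_on_eq_continuous_at holomorphic_on_imp_continuous_on of_real_0 open_ball)
      then have "((\<lambda>t. Re (f (of_real t))) \<longlongrightarrow> Re (f 0)) (at (0::real))"
        by (intro tendsto_Re isCont_tendsto_compose[of 0 f]) (auto intro!: tendsto_eq_intros)
      moreover have "\<forall>\<^sub>F t in at (0::real). Re (f (of_real t)) = sqrt (q t)"
        unfolding eventually_at using f by (intro exI[of _ r]) auto
      ultimately have "((\<lambda>t. sqrt (q t)) \<longlongrightarrow> Re (f 0)) (at (0::real))"
        by (rule Lim_transform_eventually)
      moreover have "Re (f 0) = sqrt (q 0)" using f(3)[of 0] f(1) by simp
      ultimately have "((\<lambda>t. t * sqrt (q t)) has_real_derivative sqrt (q 0)) (at 0)"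
        unfolding has_field_derivative_iff by (auto elim!: Lim_transform_eventually simp: eventually_at_filter)
      then show ?thesis using DERIV_cong_ev[OF refl ev refl] by blast
    qed
    ultimately show ?thesis using True q(2) by (intro conjI exI[of _ "sqrt (q 0)"]) auto
  next
    case False
    have Hy: "H y > 0" using H_pos assms False by blast
    have ev: "\<forall>\<^sub>F t in nhds y. sgn y * sqrt (H t) = h t"
    proof -
      have "\<forall>\<^sub>F t in nhds y. t \<in> (if y > 0 then {0<..} else {..<0})"
        by (rule eventually_nhds_in_open) (use False in auto)
      then show ?thesis
        by (rule eventually_mono) (use False in \<open>auto simp: h_def sgn_if split: if_splits\<close>)
    qed
    have "hol_ext (\<lambda>t. t * (1 / W T D a t)) y"
      by (rule hol_ext_mult[OF hol_ext_real_ident inv])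
    then have "hol_ext H y"
      using e(1) H_has_derivative[OF inJ] by (intro hol_ext_primitive[of _ y e H]) auto
    then have s: "hol_ext (\<lambda>t. sqrt (H t)) y" using Hy by (rule hol_ext_sqrt)
    have "hol_ext (\<lambda>t. sgn y * sqrt (H t)) y"
      using s hol_ext_uminus[OF s] by (cases "y > 0") (use False in \<open>auto simp: sgn_if\<close>)
    then have "hol_ext h y" using ev by (rule hol_ext_cong)
    moreover have "(h has_real_derivative sgn y * (y / W T D a y * inverse (2 * sqrt (H y)))) (at y)"
    proof -
      have "((\<lambda>t. sgn y * sqrt (H t)) has_real_derivative sgn y * (y / W T D a y * inverse (2 * sqrt (H y)))) (at y)"
        using Hy by (auto intro!: derivative_eq_intros H_has_derivative[OF assms] simp: field_simps)
      then show ?thesis using DERIV_cong_ev[OF refl ev refl] by blast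
    qed
    moreover have "sgn y * (y / W T D a y * inverse (2 * sqrt (H y))) > 0"
      using Hy Wy False by (cases "y > 0") (auto simp: sgn_if field_simps)
    ultimately show ?thesis by blast
  qed
  then show "hol_ext h y" "\<exists>d>0. (h has_real_derivative d) (at y)" by blast+
qed

lemma isCont_h: "y \<in> J \<Longrightarrow> isCont h y"
  using h_local(2) DERIV_isCont by blast

lemma h_strict_mono:
  assumes "u \<in> J" "v \<in> J" "u < v"
  shows "h u < h v"
proof (rule DERIV_pos_imp_increasing[OF assms(3)])
  fix x assume "u \<le> x" "x \<le> v"
  then have "x \<in> J" using interval_subset_J[OF assms(1,2)] by auto
  then show "\<exists>d. (h has_real_derivative d) (at x) \<and> 0 < d" using h_local(2) by blast
qed

lemma h_inj: "inj_on h J"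
  by (rule inj_onI) (metis h_strict_mono less_irrefl linorder_neqE_linordered_idom)

text \<open>The intermediate value theorem applies because \<open>H\<close> is unbounded towards
  each end of \<open>J\<close>.\<close>

lemma h_surj: "\<exists>y\<in>J. h y = u"
proof (cases "u \<ge> 0")
  case True
  obtain y where y: "y \<in> J" "y > 0" "H y > u\<^sup>2"
    using W_primitive_unbounded[OF a_nonzero, of T D H "u\<^sup>2"] H_has_derivative by blast
  then have "h y \<ge> u" using True by (simp add: h_def real_le_rsqrt less_imp_le)
  moreover have sub: "{0..y} \<subseteq> J" using interval_subset_J zero_in_J y by blast
  moreover have "isCont h x" if "0 \<le> x" "x \<le> y" for x
    using that sub by (intro isCont_h) auto
  ultimately obtain x where "0 \<le> x" "x \<le> y" "h x = u"
    using IVT[of h 0 u y] True y by auto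
  then show ?thesis using sub by auto
next
  case False
  \<comment> \<open>The reflected \<open>H\<close> is a primitive for the parameter
    \<open>- T\<close>, so the divergence result for the right end covers the left end.\<close>
  have "((\<lambda>z. H (- z)) has_real_derivative z / W (- T) D a z) (at z)" if "z \<in> W_component (- T) D a" for z
    using DERIV_chain2[OF H_has_derivative[of "- z"] DERIV_minus[OF DERIV_ident]] that mem_W_component_uminus
    by (simp add: W_uminus)
  then obtain z where z: "- z \<in> J" "z > 0" "H (- z) > u\<^sup>2"
    using W_primitive_unbounded[OF a_nonzero, of "- T" D "\<lambda>z. H (- z)" "u\<^sup>2"] mem_W_component_uminus by blast
  then have "sqrt (H (- z)) \<ge> - u"
    using False by (intro real_le_rsqrt) auto
  then have "h (- z) \<le> u" using z by (simp add: h_def)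
  moreover have sub: "{- z..0} \<subseteq> J" using interval_subset_J zero_in_J z by blast
  moreover have "isCont h x" if "- z \<le> x" "x \<le> 0" for x
    using that sub by (intro isCont_h) auto
  ultimately obtain x where "- z \<le> x" "x \<le> 0" "h x = u"
    using IVT[of h "- z" u 0] False z by auto
  then show ?thesis using sub by auto
qed

definition h_inv :: "real \<Rightarrow> real" where
  "h_inv = inv_into J h"

lemma h_inv_in_J: "h_inv u \<in> J"
  unfolding h_inv_def using h_surj by (metis image_eqI inv_into_into)

lemma h_h_inv [simp]: "h (h_inv u) = u"
  unfolding h_inv_def using h_surj by (metis image_eqI f_inv_into_f)

lemma h_inv_h: "y \<in> J \<Longrightarrow> h_inv (h y) = y"
  unfolding h_inv_def using h_inj by simp

lemma hol_ext_h_inv: "hol_ext h_inv u"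
proof -
  define y where "y = h_inv u"
  have y: "y \<in> J" "h y = u" by (simp_all add: y_def h_inv_in_J)
  obtain d where d: "d > 0" "(h has_real_derivative d) (at y)" using h_local(2) y by blast
  obtain e where e: "e > 0" "cball y e \<subseteq> J" using open_J y open_contains_cball by blast
  have "isCont h_inv (h y)"
  proof (rule isCont_inverse_function[of e y h_inv h])
    fix z assume "\<bar>z - y\<bar> \<le> e"
    then have "z \<in> J" using e by (auto simp: dist_real_def abs_minus_commute subset_iff)
    then show "h_inv (h z) = z" "isCont h z" by (simp_all add: h_inv_h isCont_h)
  qed (use e in simp)
  then have "hol_ext h_inv (h y)"
    using d h_local(1)[OF y(1)] h_inv_h[OF y(1)] by (intro hol_ext_inverse_function[of h y d]) auto
  then show ?thesis using y by simp
qed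

definition phi :: "real \<Rightarrow> real" where
  "phi y = h_inv (- h y)"

lemma phi_in_J: "phi y \<in> J"
  by (simp add: phi_def h_inv_in_J)

lemma h_phi [simp]: "h (phi y) = - h y"
  by (simp add: phi_def)

lemma phi_phi: "y \<in> J \<Longrightarrow> phi (phi y) = y"
  by (simp add: phi_def h_inv_h)

lemma hol_ext_phi: "y \<in> J \<Longrightarrow> hol_ext phi y"
  unfolding phi_def[abs_def]
  by (rule hol_ext_compose[OF hol_ext_uminus[OF h_local(1)] hol_ext_h_inv])

lemma phi_0 [simp]: "phi 0 = 0"
  using h_inv_h[OF zero_in_J] by (simp add: phi_def)

lemma phi_neg:
  assumes "y \<in> J" "y > 0"
  shows "phi y < 0"
proof (rule ccontr)
  assume "\<not> phi y < 0"
  then have "h (phi y) \<ge> h 0"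
    using h_strict_mono[OF zero_in_J phi_in_J] by (metis h_0 less_eq_real_def linorder_not_less)
  moreover have "h y > h 0" using h_strict_mono zero_in_J assms by blast
  ultimately show False by simp
qed

text \<open>As \<open>H\<close> is the square of the injective \<open>h\<close>, equal values of
  \<open>H\<close> mean equal or opposite values of \<open>h\<close>.\<close>

lemma H_eq_iff:
  assumes "u \<in> J" "v \<in> J"
  shows "H u = H v \<longleftrightarrow> u = v \<or> u = phi v"
proof -
  have "H u = H v \<longleftrightarrow> (h u)\<^sup>2 = (h v)\<^sup>2" using assms by (simp add: h_squared)
  also have "\<dots> \<longleftrightarrow> h u = h v \<or> h u = h (phi v)" by (simp add: power2_eq_iff)
  also have "\<dots> \<longleftrightarrow> u = v \<or> u = phi v"
    using h_inj assms phi_in_J by (simp add: inj_on_eq_iff del: h_phi)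
  finally show ?thesis .
qed

lemma H_phi: "y \<in> J \<Longrightarrow> H (phi y) = H y"
  using H_eq_iff phi_in_J by blast

lemma phi_unique:
  assumes "y0 \<in> J" "y1 \<in> J" "y1 < y0" "H y1 = H y0"
  shows "y1 = phi y0"
  using assms H_eq_iff by auto

end

section \<open>The flow\<close>

text \<open>A Gronwall estimate in both time directions; \<open>C\<close> comes from
  \<open>\<bar>2 * p * q\<bar> \<le> p^2 + q^2\<close> in the derivative of the energy. The first
  bound gives uniqueness and controls the velocity, the second shows that a nonzero velocity never
  vanishes later.\<close>

lemma planar_energy_growth:
  fixes p q :: "real \<Rightarrow> real"
  assumes p: "\<And>t. (p has_real_derivative T * p t - q t) (at t)"
    and q: "\<And>t. (q has_real_derivative D * p t) (at t)" and "s \<le> t"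
  defines "C \<equiv> 2 * \<bar>T\<bar> + \<bar>D\<bar> + 1"
  shows "(p t)\<^sup>2 + (q t)\<^sup>2 \<le> exp (C * (t - s)) * ((p s)\<^sup>2 + (q s)\<^sup>2)"
    and "(p s)\<^sup>2 + (q s)\<^sup>2 \<le> exp (C * (t - s)) * ((p t)\<^sup>2 + (q t)\<^sup>2)"
proof -
  define E where "E t = (p t)\<^sup>2 + (q t)\<^sup>2" for t
  define E' where "E' t = 2 * T * (p t)\<^sup>2 + (D - 1) * (2 * p t * q t)" for t
  have E: "(E has_real_derivative E' r) (at r)" for r
    unfolding E_def[abs_def] E'_def
    by (auto intro!: derivative_eq_intros p q simp: algebra_simps power2_eq_square)
  have bound: "\<bar>E' r\<bar> \<le> C * E r" for r
  proof -
    have "0 \<le> (p r + q r)\<^sup>2" "0 \<le> (p r - q r)\<^sup>2" by simp_all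
    then have "\<bar>2 * p r * q r\<bar> \<le> E r"
      unfolding E_def abs_le_iff by (simp add: power2_sum power2_diff)
    moreover have "\<bar>D - 1\<bar> \<le> \<bar>D\<bar> + 1" by simp
    ultimately have "\<bar>D - 1\<bar> * \<bar>2 * p r * q r\<bar> \<le> (\<bar>D\<bar> + 1) * E r"
      by (intro mult_mono) auto
    moreover have "2 * \<bar>T\<bar> * (p r)\<^sup>2 \<le> 2 * \<bar>T\<bar> * E r"
      by (intro mult_left_mono) (auto simp: E_def)
    moreover have "\<bar>E' r\<bar> \<le> 2 * \<bar>T\<bar> * (p r)\<^sup>2 + \<bar>D - 1\<bar> * \<bar>2 * p r * q r\<bar>"
      unfolding E'_def by (rule order_trans[OF abs_triangle_ineq]) (simp add: abs_mult)
    ultimately show ?thesis unfolding C_def by (simp add: algebra_simps)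
  qed
  have "exp (- C * t) * E t \<le> exp (- C * s) * E s"
  proof (rule DERIV_nonpos_imp_nonincreasing[OF \<open>s \<le> t\<close>])
    fix r
    have "((\<lambda>r. exp (- C * r) * E r) has_real_derivative exp (- C * r) * (E' r - C * E r)) (at r)"
      by (auto intro!: derivative_eq_intros E simp: algebra_simps)
    moreover have "exp (- C * r) * (E' r - C * E r) \<le> 0"
      using bound[of r] by (intro mult_nonneg_nonpos) auto
    ultimately show "\<exists>d. ((\<lambda>r. exp (- C * r) * E r) has_real_derivative d) (at r) \<and> d \<le> 0" by blast
  qed
  then have "exp (C * t) * (exp (- C * t) * E t) \<le> exp (C * t) * (exp (- C * s) * E s)"
    by (intro mult_left_mono) auto
  moreover have "exp (C * t) * (exp (- C * t) * E t) = E t" by (simp add: exp_minus)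
  moreover have "exp (C * t) * (exp (- C * s) * E s) = exp (C * (t - s)) * E s"
    unfolding right_diff_distrib exp_diff by (simp add: exp_minus field_simps)
  ultimately show "(p t)\<^sup>2 + (q t)\<^sup>2 \<le> exp (C * (t - s)) * ((p s)\<^sup>2 + (q s)\<^sup>2)"
    unfolding E_def[symmetric] by linarith
  have "exp (C * s) * E s \<le> exp (C * t) * E t"
  proof (rule DERIV_nonneg_imp_nondecreasing[OF \<open>s \<le> t\<close>])
    fix r
    have "((\<lambda>r. exp (C * r) * E r) has_real_derivative exp (C * r) * (E' r + C * E r)) (at r)"
      by (auto intro!: derivative_eq_intros E simp: algebra_simps)
    moreover have "exp (C * r) * (E' r + C * E r) \<ge> 0"
      using bound[of r] by (intro mult_nonneg_nonneg) auto
    ultimately show "\<exists>d. ((\<lambda>r. exp (C * r) * E r) has_real_derivative d) (at r) \<and> 0 \<le> d" by blast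
  qed
  then have "exp (- C * s) * (exp (C * s) * E s) \<le> exp (- C * s) * (exp (C * t) * E t)"
    by (intro mult_left_mono) auto
  moreover have "exp (- C * s) * (exp (C * s) * E s) = E s" by (simp add: exp_minus)
  moreover have "exp (- C * s) * (exp (C * t) * E t) = exp (C * (t - s)) * E t"
    unfolding right_diff_distrib exp_diff by (simp add: exp_minus field_simps)
  ultimately show "(p s)\<^sup>2 + (q s)\<^sup>2 \<le> exp (C * (t - s)) * ((p t)\<^sup>2 + (q t)\<^sup>2)"
    unfolding E_def[symmetric] by linarith
qed

text \<open>The difference of two solutions solves the homogeneous system with zero initial
  energy.\<close>

lemma is_solution_unique:
  assumes "is_solution T D a x y" "is_solution T D a x' y'" "x 0 = x' 0" "y 0 = y' 0" "t \<ge> 0"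
  shows "x t = x' t" "y t = y' t"
proof -
  have "(x t - x' t)\<^sup>2 + (y t - y' t)\<^sup>2
      \<le> exp ((2 * \<bar>T\<bar> + \<bar>D\<bar> + 1) * (t - 0)) * ((x 0 - x' 0)\<^sup>2 + (y 0 - y' 0)\<^sup>2)"
    by (rule planar_energy_growth(1))
       (use assms in \<open>auto intro!: derivative_eq_intros simp: is_solution_def algebra_simps\<close>)
  then show "x t = x' t" "y t = y' t" using assms(3,4) by (simp_all add: sum_power2_le_zero_iff)
qed

text \<open>Of two different return times the smaller would be a zero of \<open>x\<close> inside the
  excursion belonging to the larger.\<close>

lemma left_return_unique:
  assumes "left_return T D a y0 y1" "left_return T D a y0 y2"
  shows "y1 = y2"
proof -
  from assms(1) obtain x y \<tau> where 1: "is_solution T D a x y" "x 0 = 0" "y 0 = y0" "\<tau> > 0"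
    "x \<tau> = 0" "\<And>t. 0 < t \<Longrightarrow> t < \<tau> \<Longrightarrow> x t < 0" "y \<tau> = y1"
    unfolding left_return_def by auto
  from assms(2) obtain x' y' \<tau>' where 2: "is_solution T D a x' y'" "x' 0 = 0" "y' 0 = y0" "\<tau>' > 0"
    "x' \<tau>' = 0" "\<And>t. 0 < t \<Longrightarrow> t < \<tau>' \<Longrightarrow> x' t < 0" "y' \<tau>' = y2"
    unfolding left_return_def by auto
  have eq: "x t = x' t" "y t = y' t" if "t \<ge> 0" for t
    using is_solution_unique[OF 1(1) 2(1)] 1 2 that by auto
  have "\<tau> = \<tau>'"
    using 1(4-6) 2(4-6) eq(1)[of \<tau>] eq(1)[of \<tau>'] by (metis less_imp_le less_irrefl linorder_neqE_linordered_idom)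
  then show ?thesis using eq(2)[of \<tau>] 1 2 by auto
qed

text \<open>Variation of constants, with an entire primitive of
  \<open>exp (- \<mu> * z) * f z\<close>.\<close>

lemma entire_linear_ode:
  fixes \<mu> c :: complex
  assumes "f holomorphic_on UNIV"
  obtains u where "u 0 = c" "\<And>z. (u has_field_derivative \<mu> * u z + f z) (at z)"
proof -
  have "(\<lambda>z. exp (- \<mu> * z) * f z) holomorphic_on UNIV"
    by (intro holomorphic_intros assms)
  then obtain G where G: "\<And>z. (G has_field_derivative exp (- \<mu> * z) * f z) (at z)"
    using holomorphic_convex_primitive'[of UNIV "\<lambda>z. exp (- \<mu> * z) * f z"] by auto
  define u where "u z = exp (\<mu> * z) * (c + G z - G 0)" for z
  show ?thesis
  proof (rule that[of u])
    fix z
    have "exp (\<mu> * z) * (exp (- \<mu> * z) * f z) = f z" by (simp add: exp_minus)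
    then show "(u has_field_derivative \<mu> * u z + f z) (at z)"
      unfolding u_def[abs_def] by (auto intro!: derivative_eq_intros G simp: algebra_simps)
  qed (simp add: u_def)
qed

text \<open>Over the complex numbers \<open>x'' - T x' + D x = a\<close> splits into \<open>u' = \<lambda> u + a\<close> and
  \<open>x' = \<mu> x + u\<close>, where \<open>\<lambda>\<close> and \<open>\<mu>\<close> are the eigenvalues.\<close>

lemma is_solution_exists:
  obtains x y where "is_solution T D a x y" "x 0 = 0" "y 0 = y0"
proof -
  define r where "r = csqrt (of_real (T\<^sup>2 - 4 * D))"
  define l where "l = (of_real T + r) / 2"
  define m where "m = (of_real T - r) / 2"
  have r2: "r\<^sup>2 = of_real (T\<^sup>2 - 4 * D)" unfolding r_def by (rule power2_csqrt)
  have lm: "l + m = of_real T" by (simp add: l_def m_def field_simps)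
  have "l * m = (of_real (T\<^sup>2) - r\<^sup>2) / 4" by (simp add: l_def m_def field_simps power2_eq_square)
  then have lm': "l * m = of_real D" unfolding r2 by simp
  \<comment> \<open>At time \<open>0\<close> the equation for \<open>x\<close> reads
    \<open>x' = - y0\<close>; since \<open>v 0 = 0\<close>, this is the initial value of
    \<open>u\<close>.\<close>
  obtain u where u: "u 0 = - of_real y0" "\<And>z. (u has_field_derivative l * u z + of_real a) (at z)"
    using entire_linear_ode[of "\<lambda>_. of_real a" "- of_real y0" l] by auto
  have "u holomorphic_on UNIV" using u(2) holomorphic_on_open[of UNIV u] by auto
  then obtain v where v: "v 0 = 0" "\<And>z. (v has_field_derivative m * v z + u z) (at z)"
    using entire_linear_ode[of u 0 m] by auto
  define x where "x t = Re (v (of_real t))" for t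
  \<comment> \<open>Solved from the first equation, \<open>y = T x - x'\<close>.\<close>
  define y where "y t = T * x t - Re (m * v (of_real t) + u (of_real t))" for t
  have vt: "((\<lambda>t. v (of_real t)) has_vector_derivative m * v (of_real t) + u (of_real t)) (at t)" for t
    by (rule has_vector_derivative_real_field[OF v(2)])
  have ut: "((\<lambda>t. u (of_real t)) has_vector_derivative l * u (of_real t) + of_real a) (at t)" for t
    by (rule has_vector_derivative_real_field[OF u(2)])
  have dx: "(x has_real_derivative T * x t - y t) (at t)" for t
    using has_field_derivative_Re[OF vt[of t]] by (simp add: x_def[abs_def] y_def algebra_simps)
  have dy: "(y has_real_derivative D * x t - a) (at t)" for t
  proof -
    define V where "V = v (of_real t)"
    define U where "U = u (of_real t)"
    have "((\<lambda>t. m * v (of_real t) + u (of_real t)) has_vector_derivative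
        m * (m * V + U) + (l * U + of_real a)) (at t)"
      unfolding V_def U_def
      by (intro has_vector_derivative_add ut has_vector_derivative_mult_right vt)
    from has_field_derivative_Re[OF this]
    have "(y has_real_derivative T * (T * x t - y t) - Re (m * (m * V + U) + (l * U + of_real a))) (at t)"
      unfolding y_def[abs_def, symmetric]
      using DERIV_diff[OF DERIV_cmult[OF dx[of t], of T]] by (simp add: y_def[abs_def])
    moreover have "T * (T * x t - y t) = Re (of_real T * (m * V + U))"
      by (simp add: y_def V_def U_def)
    moreover have "Re (of_real T * (m * V + U)) - Re (m * (m * V + U) + (l * U + of_real a)) = D * x t - a"
    proof -
      \<comment> \<open>With \<open>T = l + m\<close> the terms in \<open>U\<close> cancel and
        \<open>l * m * V\<close> remains, which is \<open>D * V\<close>.\<close>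
      have "of_real T * (m * V + U) - (m * (m * V + U) + (l * U + of_real a)) = of_real D * V - of_real a"
        unfolding lm[symmetric] lm'[symmetric] by (simp add: algebra_simps)
      from arg_cong[OF this, of Re] show ?thesis
        unfolding minus_complex.sel by (simp add: x_def V_def)
    qed
    ultimately show ?thesis by (simp only:)
  qed
  have "is_solution T D a x y" unfolding is_solution_def using dx dy by blast
  moreover have "x 0 = 0" "y 0 = y0" using u v by (simp_all add: x_def y_def)
  ultimately show ?thesis using that by blast
qed

section \<open>Velocity and slope along an orbit\<close>

text \<open>\<open>(p, q)\<close> is the velocity of the solution. The quadratic form \<open>V\<close> is the inverse integrating
  factor of the system: it vanishes on the invariant lines through the equilibrium.\<close>

locale half_map_solution = half_map_params +
  fixes x y :: "real \<Rightarrow> real"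
  assumes sol: "is_solution T D a x y"
begin

definition p :: "real \<Rightarrow> real" where "p t = T * x t - y t"
definition q :: "real \<Rightarrow> real" where "q t = D * x t - a"
definition V :: "real \<Rightarrow> real" where "V t = D * (p t)\<^sup>2 - T * p t * q t + (q t)\<^sup>2"

lemma x_deriv: "(x has_real_derivative p t) (at t)"
  using sol by (simp add: is_solution_def p_def)

lemma p_deriv: "(p has_real_derivative T * p t - q t) (at t)"
  unfolding p_def[abs_def] using sol
  by (auto intro!: derivative_eq_intros simp: is_solution_def q_def)

lemma q_deriv: "(q has_real_derivative D * p t) (at t)"
  unfolding q_def[abs_def] by (auto intro!: derivative_eq_intros x_deriv)

text \<open>The form satisfies \<open>V' = T V\<close>, so its sign is constant along the
  orbit.\<close>

lemma V_eq: "V t = exp (T * (t - s)) * V s"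
proof -
  have "((\<lambda>t. exp (- T * t) * V t) has_real_derivative 0) (at t)" for t
    unfolding V_def[abs_def]
    by (auto intro!: derivative_eq_intros p_deriv q_deriv simp: algebra_simps power2_eq_square)
  then have "exp (- T * t) * V t = exp (- T * s) * V s"
    using DERIV_isconst_all by blast
  then have "exp (T * t) * (exp (- T * t) * V t) = exp (T * t) * (exp (- T * s) * V s)" by simp
  moreover have "exp (T * t) * (exp (- T * t) * V t) = V t" by (simp add: exp_minus)
  moreover have "exp (T * t) * (exp (- T * s) * V s) = exp (T * (t - s)) * V s"
    unfolding right_diff_distrib exp_diff by (simp add: exp_minus field_simps)
  ultimately show ?thesis by simp
qed

lemma V_section: "x t = 0 \<Longrightarrow> V t = W T D a (y t)"
  by (simp add: V_def p_def q_def W_def power2_eq_square algebra_simps)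

lemma V_slope: "q t \<noteq> 0 \<Longrightarrow> W T D a (a * p t / q t) = a\<^sup>2 * V t / (q t)\<^sup>2"
  by (simp add: V_def W_def field_simps power2_eq_square)

lemma slope_deriv:
  "q t \<noteq> 0 \<Longrightarrow> ((\<lambda>t. a * p t / q t) has_real_derivative - a * V t / (q t)\<^sup>2) (at t)"
  by (auto intro!: derivative_eq_intros p_deriv q_deriv simp: V_def field_simps power2_eq_square)

lemma isCont_q: "isCont q t"
  using q_deriv by (rule DERIV_isCont)

text \<open>Between two zeros \<open>x\<close> has a critical point, and there
  \<open>V = q^2\<close>. If \<open>q\<close> vanished as well, the velocity would have been zero
  from the start, contrary to \<open>q 0 = - a\<close>.\<close>

lemma stationary:
  assumes "x 0 = 0" "\<tau> > 0" "x \<tau> = 0"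
  obtains s where "0 < s" "s < \<tau>" "p s = 0" "\<And>t. V t > 0"
proof -
  obtain s where s: "0 < s" "s < \<tau>" "x \<tau> - x 0 = (\<tau> - 0) * p s"
    using MVT2[OF assms(2), where f = x and f' = p] x_deriv by blast
  then have ps: "p s = 0" using assms by simp
  have "q s \<noteq> 0"
  proof
    assume "q s = 0"
    then have "(p 0)\<^sup>2 + (q 0)\<^sup>2 \<le> 0"
      using planar_energy_growth(2)[of p T q D 0 s] p_deriv q_deriv s ps by simp
    then have "q 0 = 0" by (simp add: sum_power2_le_zero_iff)
    then show False using assms(1) a_nonzero by (simp add: q_def)
  qed
  then have "V s > 0" by (simp add: V_def ps)
  then have "V t > 0" for t using V_eq[of t s] by simp
  with s ps that show ?thesis by blast
qed

text \<open>Keeps the slope finite during the excursion. For \<open>D \<ge> 0\<close> the sign of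
  \<open>x\<close> gives \<open>q \<le> - a\<close>; for \<open>D < 0\<close> a zero of
  \<open>q\<close> would make \<open>V = D * p^2\<close> nonpositive.\<close>

lemma q_neg:
  assumes "a > 0" "x 0 = 0" "x \<tau> = 0" "\<And>t. 0 < t \<Longrightarrow> t < \<tau> \<Longrightarrow> x t < 0"
    and V: "\<And>t. V t > 0" and t: "0 \<le> t" "t \<le> \<tau>"
  shows "q t < 0"
proof (cases "D \<ge> 0")
  case True
  have "x t \<le> 0" using assms(2,3) assms(4)[of t] t by (cases "t = 0"; cases "t = \<tau>") auto
  then have "D * x t \<le> 0" using True by (simp add: mult_nonneg_nonpos)
  then show ?thesis using \<open>a > 0\<close> by (simp add: q_def)
next
  case False
  show ?thesis
  proof (rule ccontr)
    assume "\<not> q t < 0"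
    moreover have "q 0 < 0" using assms(1,2) by (simp add: q_def)
    ultimately obtain s where "q s = 0"
      using IVT[of q 0 0 t] t isCont_q by auto
    then have "V s = D * (p s)\<^sup>2" by (simp add: V_def)
    also have "\<dots> \<le> 0" using False by (intro mult_nonpos_nonneg) auto
    finally show False using V[of s] by simp
  qed
qed

text \<open>The slope \<open>z\<close> equals \<open>y\<close> at both crossings of the section and
  decreases strictly from one to the other through \<open>0\<close>, which gives the signs. The last
  claim comes from a first integral in \<open>z\<close> and \<open>x\<close>.\<close>

lemma left_return_pos_a:
  assumes "a > 0" "x 0 = 0" "\<tau> > 0" "x \<tau> = 0" "\<And>t. 0 < t \<Longrightarrow> t < \<tau> \<Longrightarrow> x t < 0"
  shows "y \<tau> < 0" "0 < y 0" "y 0 \<in> J" "y \<tau> \<in> J" "H (y \<tau>) = H (y 0)"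
proof -
  obtain s where s: "0 < s" "s < \<tau>" "p s = 0" and V: "\<And>t. V t > 0"
    using stationary[OF assms(2-4)] by blast
  have q: "q t < 0" if "0 \<le> t" "t \<le> \<tau>" for t
    using q_neg[OF assms(1,2,4,5) V that] by blast
  define z where "z t = a * p t / q t" for t
  have z': "(z has_real_derivative - a * V t / (q t)\<^sup>2) (at t)" if "0 \<le> t" "t \<le> \<tau>" for t
    unfolding z_def[abs_def] using slope_deriv[of t] q[OF that] by simp
  have neg: "- a * V t / (q t)\<^sup>2 < 0" if "0 \<le> t" "t \<le> \<tau>" for t
    using q[OF that] V[of t] \<open>a > 0\<close> by (simp add: divide_neg_pos)
  have z_ends: "z 0 = y 0" "z \<tau> = y \<tau>" "z s = 0"
    using assms(1,2,4) s by (simp_all add: z_def p_def q_def)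
  have z_dec: "z v < z u" if uv: "0 \<le> u" "u < v" "v \<le> \<tau>" for u v
  proof (rule DERIV_neg_imp_decreasing[OF uv(2)])
    fix t assume "u \<le> t" "t \<le> v"
    then have t: "0 \<le> t" "t \<le> \<tau>" using uv by auto
    show "\<exists>d. (z has_real_derivative d) (at t) \<and> d < 0" using z'[OF t] neg[OF t] by blast
  qed
  have "z s < z 0" "z \<tau> < z s" using z_dec s by auto
  then show signs: "y \<tau> < 0" "0 < y 0" using z_ends by auto
  have W_z: "W T D a (z t) > 0" if "0 \<le> t" "t \<le> \<tau>" for t
    using V_slope[of t] q[OF that] V[of t] \<open>a > 0\<close> by (simp add: z_def)
  \<comment> \<open>Each intermediate \<open>u\<close> is a value of the slope, where
    \<open>W\<close> is a positive multiple of \<open>V\<close>; hence both ends lie in the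
    component of \<open>0\<close>.\<close>
  have W_pos': "W T D a u > 0" if u: "y \<tau> \<le> u" "u \<le> y 0" for u
  proof -
    have "\<exists>t. 0 \<le> t \<and> t \<le> \<tau> \<and> z t = u"
    proof (rule IVT2)
      show "\<forall>t. 0 \<le> t \<and> t \<le> \<tau> \<longrightarrow> isCont z t" using z' DERIV_isCont by blast
    qed (use u z_ends assms(3) in simp_all)
    then show ?thesis using W_z by blast
  qed
  show inJ: "y 0 \<in> J" "y \<tau> \<in> J"
    using signs W_pos' by (auto simp: mem_W_component_iff closed_segment_eq_real_ivl)
  have z_J: "z t \<in> J" if t: "0 \<le> t" "t \<le> \<tau>" for t
  proof -
    have "z \<tau> \<le> z t" using z_dec[of t \<tau>] t by (cases "t = \<tau>") auto
    moreover have "z t \<le> z 0" using z_dec[of 0 t] t by (cases "t = 0") auto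
    ultimately show ?thesis
      using interval_subset_J[OF inJ(2,1)] z_ends by auto
  qed
  \<comment> \<open>Along the orbit \<open>H (z t)\<close> has derivative \<open>- p / q\<close>,
    and \<open>q = D * x - a\<close>; a primitive \<open>L\<close> of \<open>1 / (D * u - a)\<close>
    makes \<open>H (z t) + L (x t)\<close> constant. The logarithmic formula degenerates at
    \<open>D = 0\<close>.\<close>
  obtain L where L: "\<And>u. D * u - a < 0 \<Longrightarrow> (L has_real_derivative 1 / (D * u - a)) (at u)"
  proof (cases "D = 0")
    case True
    have "((\<lambda>u. - u / a) has_real_derivative 1 / (D * u - a)) (at u)" for u
      using True \<open>a > 0\<close> by (auto intro!: derivative_eq_intros)
    then show ?thesis using that by blast
  next
    case False
    have "((\<lambda>u. ln (a - D * u) / D) has_real_derivative 1 / (D * u - a)) (at u)" if "D * u - a < 0" for u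
      using that False by (auto intro!: derivative_eq_intros simp: field_simps)
    then show ?thesis using that by blast
  qed
  have "H (z \<tau>) + L (x \<tau>) = H (z 0) + L (x 0)"
  proof (rule DERIV_isconst2[OF assms(3)])
    have d: "((\<lambda>t. H (z t) + L (x t)) has_real_derivative 0) (at t)" if t: "0 \<le> t" "t \<le> \<tau>" for t
    proof -
      have qt: "q t < 0" using q t by blast
      have "((\<lambda>t. H (z t)) has_real_derivative z t / W T D a (z t) * (- a * V t / (q t)\<^sup>2)) (at t)"
        by (rule DERIV_chain2[OF H_has_derivative[OF z_J[OF t]] z'[OF t]])
      moreover have "((\<lambda>t. L (x t)) has_real_derivative 1 / (D * x t - a) * p t) (at t)"
        by (rule DERIV_chain2[OF L x_deriv]) (use qt in \<open>simp add: q_def\<close>)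
      moreover have "z t / W T D a (z t) * (- a * V t / (q t)\<^sup>2) + 1 / (D * x t - a) * p t = 0"
        using V_slope[of t] qt V[of t] \<open>a > 0\<close>
        by (simp add: z_def q_def[symmetric] power2_eq_square)
      ultimately show ?thesis using DERIV_add by fastforce
    qed
    then show "continuous_on {0..\<tau>} (\<lambda>t. H (z t) + L (x t))"
      by (intro continuous_at_imp_continuous_on ballI DERIV_isCont) auto
    show "((\<lambda>t. H (z t) + L (x t)) has_real_derivative 0) (at t)" if "0 < t" "t < \<tau>" for t
      using d that by simp
  qed (use assms(3) in auto)
  then show "H (y \<tau>) = H (y 0)" using z_ends assms(2,4) by simp
qed

text \<open>With \<open>a < 0\<close> the slope increases as long as \<open>q\<close> is nonzero, so
  the excursion has to pass a zero of \<open>q\<close>. There \<open>D * x = a\<close>, which fixes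
  the sign of \<open>D\<close>; moving \<open>q\<close> from \<open>- a\<close> to \<open>0\<close>
  at bounded speed takes time, which is the final inequality.\<close>

lemma left_return_neg_a:
  assumes "a < 0" "x 0 = 0" "\<tau> > 0" "x \<tau> = 0" "\<And>t. 0 < t \<Longrightarrow> t < \<tau> \<Longrightarrow> x t < 0" "y 0 \<ge> 0"
  defines "C \<equiv> 2 * \<bar>T\<bar> + \<bar>D\<bar> + 1"
  shows "D > 0" "W T D a (y 0) > 0" "W T D a (y \<tau>) = exp (T * \<tau>) * W T D a (y 0)"
    and "a\<^sup>2 \<le> D\<^sup>2 * \<tau>\<^sup>2 * exp (C * \<tau>) * ((y 0)\<^sup>2 + a\<^sup>2)"
proof -
  obtain s where s: "0 < s" "s < \<tau>" "p s = 0" and V: "\<And>t. V t > 0"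
    using stationary[OF assms(2-4)] by blast
  show "W T D a (y 0) > 0" using V[of 0] V_section assms(2) by simp
  show "W T D a (y \<tau>) = exp (T * \<tau>) * W T D a (y 0)"
    using V_eq[of \<tau> 0] V_section assms(2,4) by simp
  \<comment> \<open>Otherwise the slope would rise strictly from \<open>y 0 \<ge> 0\<close> to its
    value \<open>0\<close> at the stationary time \<open>s\<close>.\<close>
  have "\<exists>r. 0 \<le> r \<and> r \<le> s \<and> q r = 0"
  proof (rule ccontr)
    assume no: "\<not> ?thesis"
    have q: "q t > 0" if t: "0 \<le> t" "t \<le> s" for t
    proof (rule ccontr)
      assume "\<not> q t > 0"
      moreover have "q 0 > 0" using assms(1,2) by (simp add: q_def)
      ultimately obtain r where "0 \<le> r" "r \<le> t" "q r = 0"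
        using IVT2[of q t 0 0] t isCont_q by auto
      with no t show False by auto
    qed
    have "(\<lambda>t. a * p t / q t) 0 < (\<lambda>t. a * p t / q t) s"
    proof (rule DERIV_pos_imp_increasing[OF s(1)])
      fix t assume t: "0 \<le> t" "t \<le> s"
      have "- a * V t / (q t)\<^sup>2 > 0" using V[of t] q[OF t] \<open>a < 0\<close> by (simp add: divide_neg_pos mult_neg_pos)
      moreover have "q t \<noteq> 0" using q[OF t] by simp
      ultimately show "\<exists>d. ((\<lambda>t. a * p t / q t) has_real_derivative d) (at t) \<and> 0 < d"
        using slope_deriv by blast
    qed
    moreover have "a * p 0 / q 0 = y 0" using assms(1,2) by (simp add: p_def q_def)
    ultimately show False using s(3) assms(6) by simp
  qed
  then obtain r where r: "0 \<le> r" "r \<le> s" "q r = 0" by blast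
  moreover have "q 0 \<noteq> 0" using a_nonzero assms(2) by (simp add: q_def)
  ultimately have r0: "0 < r" "r < \<tau>" using s by (auto simp: order_less_le)
  have Dx: "D * x r = a" using r by (simp add: q_def)
  then have "D * x r < 0" using \<open>a < 0\<close> by simp
  then show "D > 0" using assms(5)[OF r0] by (simp add: mult_less_0_iff)
  \<comment> \<open>The mean value theorem turns the change of \<open>q\<close> into a lower bound
    for \<open>p c\<close>, to be set against the growth of the energy.\<close>
  obtain c where c: "0 < c" "c < r" "q r - q 0 = (r - 0) * (D * p c)"
    using MVT2[OF r0(1), where f = q and f' = "\<lambda>t. D * p t"] q_deriv by blast
  moreover have "q 0 = - a" using assms(2) by (simp add: q_def)
  ultimately have "a = r * D * p c" using r(3) by simp
  then have "a\<^sup>2 = D\<^sup>2 * r\<^sup>2 * (p c)\<^sup>2" by (metis mult.commute power_mult_distrib)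
  also have "\<dots> \<le> D\<^sup>2 * \<tau>\<^sup>2 * (exp (C * \<tau>) * ((y 0)\<^sup>2 + a\<^sup>2))"
  proof (intro mult_mono)
    show "r\<^sup>2 \<le> \<tau>\<^sup>2" using r0 by (intro power_mono) auto
    have "(p c)\<^sup>2 \<le> (p c)\<^sup>2 + (q c)\<^sup>2" by simp
    also have "\<dots> \<le> exp (C * (c - 0)) * ((p 0)\<^sup>2 + (q 0)\<^sup>2)"
      unfolding C_def using planar_energy_growth(1)[of p T q D 0 c] p_deriv q_deriv c by simp
    also have "(p 0)\<^sup>2 + (q 0)\<^sup>2 = (y 0)\<^sup>2 + a\<^sup>2" using assms(2) by (simp add: p_def q_def)
    also have "exp (C * (c - 0)) * ((y 0)\<^sup>2 + a\<^sup>2) \<le> exp (C * \<tau>) * ((y 0)\<^sup>2 + a\<^sup>2)"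
      using c r0 by (intro mult_right_mono) (auto simp: C_def intro!: mult_left_mono)
    finally show "(p c)\<^sup>2 \<le> exp (C * \<tau>) * ((y 0)\<^sup>2 + a\<^sup>2)" .
  qed auto
  finally show "a\<^sup>2 \<le> D\<^sup>2 * \<tau>\<^sup>2 * exp (C * \<tau>) * ((y 0)\<^sup>2 + a\<^sup>2)" by (simp add: mult.assoc)
qed

end

text \<open>The equilibrium is a center with \<open>x = a / D < 0\<close>; the orbit is an explicit
  cosine, symmetric under reflection of \<open>y\<close>.\<close>

lemma left_return_center:
  assumes "a < 0" "D > 0" "y0 \<ge> 0"
  shows "left_return 0 D a y0 (- y0)"
proof -
  define \<omega> where "\<omega> = sqrt D"
  have \<omega>: "\<omega> > 0" "\<omega> * \<omega> = D" using assms by (simp_all add: \<omega>_def)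
  \<comment> \<open>The phase at which the orbit through \<open>(0, y0)\<close> starts, determined
    by \<open>y 0 = y0\<close>.\<close>
  define \<beta> where "\<beta> = arctan (y0 * \<omega> / (- a))"
  have "y0 * \<omega> / (- a) \<ge> 0" using assms \<omega> by (intro divide_nonneg_pos mult_nonneg_nonneg) auto
  then have \<beta>: "0 \<le> \<beta>" "\<beta> < pi / 2" "tan \<beta> = y0 * \<omega> / (- a)"
    unfolding \<beta>_def using arctan_ubound[of "y0 * \<omega> / (- a)"] by (auto simp: tan_arctan)
  have cos: "cos \<beta> > 0" using \<beta> by (intro cos_gt_zero_pi) auto
  define x where "x t = a / D * (1 - cos (\<omega> * t + \<beta>) / cos \<beta>)" for t
  define y where "y t = - (a / \<omega>) * (sin (\<omega> * t + \<beta>) / cos \<beta>)" for t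
  have a\<omega>: "a / D * \<omega> = a / \<omega>" using \<omega>(1) unfolding \<omega>(2)[symmetric] by simp
  \<comment> \<open>The phase moves from \<open>\<beta>\<close> to \<open>2 * pi - \<beta>\<close>,
    the next angle with the same cosine; the sine has changed sign.\<close>
  define \<tau> where "\<tau> = (2 * pi - 2 * \<beta>) / \<omega>"
  have \<tau>: "\<omega> * \<tau> + \<beta> = 2 * pi - \<beta>" using \<omega> by (simp add: \<tau>_def)
  have "sin \<beta> / cos \<beta> = y0 * \<omega> / (- a)" using \<beta>(3) by (simp add: tan_def)
  then have y0: "(a / \<omega>) * (sin \<beta> / cos \<beta>) = - y0"
    by (simp only:) (use \<omega>(1) assms(1) in simp)
  have "is_solution 0 D a x y"
    unfolding is_solution_def
  proof (intro allI conjI)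
    fix t
    have "(x has_real_derivative a / D * (\<omega> * sin (\<omega> * t + \<beta>) / cos \<beta>)) (at t)"
      unfolding x_def[abs_def] using cos assms by (auto intro!: derivative_eq_intros simp: mult_ac)
    also have "a / D * (\<omega> * sin (\<omega> * t + \<beta>) / cos \<beta>) = (a / D * \<omega>) * (sin (\<omega> * t + \<beta>) / cos \<beta>)" by (simp add: mult_ac)
    also have "\<dots> = 0 * x t - y t" unfolding a\<omega> by (simp add: y_def)
    finally show "(x has_real_derivative 0 * x t - y t) (at t)" .
    have "(y has_real_derivative - (a / \<omega>) * (\<omega> * cos (\<omega> * t + \<beta>) / cos \<beta>)) (at t)"
      unfolding y_def[abs_def] using cos \<omega> by (auto intro!: derivative_eq_intros)
    also have "- (a / \<omega>) * (\<omega> * cos (\<omega> * t + \<beta>) / cos \<beta>) = D * x t - a"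
      using \<omega> assms by (simp add: x_def right_diff_distrib)
    finally show "(y has_real_derivative D * x t - a) (at t)" .
  qed
  moreover have "x 0 = 0" using cos by (simp add: x_def)
  moreover have "y 0 = y0" using y0 by (simp add: y_def)
  moreover have "\<tau> > 0" using \<beta> \<omega> by (simp add: \<tau>_def)
  moreover have "x \<tau> = 0" using cos by (simp add: x_def \<tau>)
  moreover have "y \<tau> = - y0" using y0 by (simp add: y_def \<tau>)
  moreover have "x t < 0" if "t \<in> {0<..<\<tau>}" for t
  proof -
    define \<theta> where "\<theta> = \<omega> * t + \<beta>"
    have "0 < \<omega> * t" "\<omega> * t < \<omega> * \<tau>" using that \<omega> by simp_all
    then have \<theta>: "\<beta> < \<theta>" "\<theta> < 2 * pi - \<beta>" using \<tau> unfolding \<theta>_def by linarith+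
    have "cos \<theta> < cos \<beta>"
    proof (cases "\<theta> \<le> pi")
      case True
      then show ?thesis using \<theta> \<beta> by (intro cos_monotone_0_pi) auto
    next
      case False
      then have "cos (2 * pi - \<theta>) < cos \<beta>" using \<theta> \<beta> by (intro cos_monotone_0_pi) auto
      then show ?thesis by simp
    qed
    then have "cos \<theta> / cos \<beta> < 1" using cos by simp
    then show ?thesis using assms by (simp add: x_def \<theta>_def[symmetric] mult_neg_pos divide_neg_pos)
  qed
  ultimately show ?thesis unfolding left_return_def using assms(3) by blast
qed

text \<open>For \<open>T = 0\<close> both \<open>W\<close> and \<open>H\<close> are even, so
  \<open>- y\<close> is the partner of \<open>y\<close>.\<close>

lemma (in half_map_params) phi_T_0:
  assumes "T = 0" "y \<in> J" "- y \<in> J"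
  shows "phi y = - y"
proof -
  have Jm: "z \<in> J \<longleftrightarrow> - z \<in> J" for z
    using mem_W_component_uminus[of z T D a] assms(1) by simp
  have "\<exists>c. \<forall>z\<in>J. H (- z) - H z = c"
  proof (rule has_field_derivative_zero_constant[OF convex_J])
    fix z assume z: "z \<in> J"
    have "((\<lambda>z. H (- z)) has_real_derivative - z / W T D a (- z) * - 1) (at z)"
      using DERIV_chain2[OF H_has_derivative[of "- z"] DERIV_minus[OF DERIV_ident]] z Jm by blast
    from DERIV_diff[OF this H_has_derivative[OF z]]
    show "((\<lambda>z. H (- z) - H z) has_real_derivative 0) (at z within J)"
      using assms(1) by (simp add: W_uminus has_field_derivative_at_within)
  qed
  then obtain c where c: "\<And>z. z \<in> J \<Longrightarrow> H (- z) - H z = c" by blast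
  have "H (- y) = H y" using c[OF zero_in_J] c[OF assms(2)] by simp
  then show ?thesis using H_eq_iff[OF assms(3,2)] by auto
qed

section \<open>Which returns occur, and the graph of the half-map\<close>

context half_map_params begin

text \<open>Converse direction for \<open>a > 0\<close>: the orbit is parametrised by the slope \<open>w = a p / q\<close>, with
  time \<open>\<theta> w\<close> given by the integral of \<open>a / W\<close> from \<open>w\<close> to \<open>y0\<close>. In this parametrisation \<open>p\<close>, \<open>q\<close> and \<open>x\<close> are
  explicit functions of \<open>H w\<close>.\<close>

lemma left_return_phi:
  assumes "a > 0" "y0 \<in> J" "y0 > 0"
  shows "left_return T D a y0 (phi y0)"
proof -
  obtain x y where sol: "is_solution T D a x y" and init: "x 0 = 0" "y 0 = y0"
    by (rule is_solution_exists)
  interpret half_map_solution T D a x y by unfold_locales (rule sol)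
  define G where "G w = (LBINT s=ereal 0..ereal w. 1 / W T D a s)" for w
  have G: "(G has_real_derivative 1 / W T D a w) (at w)" if "w \<in> J" for w
    unfolding G_def[abs_def]
    by (intro integral_from_0_has_derivative continuous_on_div_W continuous_intros that)
  define \<theta> where "\<theta> w = a * (G y0 - G w)" for w
  have \<theta>: "(\<theta> has_real_derivative - (a / W T D a w)) (at w)" if "w \<in> J" for w
    unfolding \<theta>_def[abs_def] using that by (auto intro!: derivative_eq_intros G)
  have p\<theta>: "((\<lambda>w. p (\<theta> w)) has_real_derivative (T * p (\<theta> w) - q (\<theta> w)) * - (a / W T D a w)) (at w)"
    and q\<theta>: "((\<lambda>w. q (\<theta> w)) has_real_derivative D * p (\<theta> w) * - (a / W T D a w)) (at w)"
    and x\<theta>: "((\<lambda>w. x (\<theta> w)) has_real_derivative p (\<theta> w) * - (a / W T D a w)) (at w)" if "w \<in> J" for w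
    by (rule DERIV_chain2[OF p_deriv \<theta>[OF that]] DERIV_chain2[OF q_deriv \<theta>[OF that]]
        DERIV_chain2[OF x_deriv \<theta>[OF that]])+
  have const: "f w = f y0" if "\<And>w. w \<in> J \<Longrightarrow> (f has_real_derivative 0) (at w)" "w \<in> J" for f :: "real \<Rightarrow> real" and w
    using has_field_derivative_zero_constant[OF convex_J, of f] that assms(2)
    by (metis has_field_derivative_at_within)
  have \<theta>0: "\<theta> y0 = 0" by (simp add: \<theta>_def)
  have pq: "p (\<theta> w) = w / a * q (\<theta> w)" if "w \<in> J" for w
  proof -
    define A where "A w = p (\<theta> w) - w / a * q (\<theta> w)" for w
    \<comment> \<open>An integrating factor: the defect \<open>A\<close> satisfies
      \<open>A' = - r * A\<close> while \<open>K' = r * K\<close>, so \<open>A * K\<close> is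
      constant, and \<open>A y0 = 0\<close>.\<close>
    define K where "K w = exp (- T * \<theta> w - D * H w)" for w
    have "((\<lambda>w. A w * K w) has_real_derivative 0) (at w)" if w: "w \<in> J" for w
    proof -
      have Wn: "W T D a w \<noteq> 0" using W_pos[OF w] by simp
      define r where "r = T * a / W T D a w - D * w / W T D a w"
      have "(A has_real_derivative (T * p (\<theta> w) - q (\<theta> w)) * - (a / W T D a w)
          - (1 / a * q (\<theta> w) + w / a * (D * p (\<theta> w) * - (a / W T D a w)))) (at w)"
        unfolding A_def[abs_def] using a_nonzero
        by (auto intro!: derivative_eq_intros p\<theta>[OF w] q\<theta>[OF w] simp: diff_divide_distrib)
      moreover have "(T * p (\<theta> w) - q (\<theta> w)) * - (a / W T D a w)
          - (1 / a * q (\<theta> w) + w / a * (D * p (\<theta> w) * - (a / W T D a w))) = - r * A w"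
      proof -
        have "q (\<theta> w) / a = q (\<theta> w) * (D * w\<^sup>2 - a * T * w + a\<^sup>2) / (a * W T D a w)"
          using Wn a_nonzero by (simp add: W_def)
        then show ?thesis unfolding r_def A_def using Wn a_nonzero
          by (simp add: divide_simps) (simp add: algebra_simps power2_eq_square W_def)
      qed
      ultimately have dA: "(A has_real_derivative - r * A w) (at w)" by simp
      have "(K has_real_derivative K w * (- T * - (a / W T D a w) - D * (w / W T D a w))) (at w)"
        unfolding K_def[abs_def] by (auto intro!: derivative_eq_intros \<theta>[OF w] H_has_derivative[OF w] simp: mult_ac)
      moreover have "- T * - (a / W T D a w) - D * (w / W T D a w) = r"
        by (simp add: r_def)
      ultimately have dK: "(K has_real_derivative K w * r) (at w)" by simp
      show ?thesis using DERIV_mult[OF dA dK] by (simp add: algebra_simps)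
    qed
    from const[OF this that] have "A w * K w = A y0 * K y0" .
    also have "A y0 = 0" using init a_nonzero by (simp add: A_def \<theta>0 p_def q_def)
    finally show ?thesis by (simp add: A_def K_def)
  qed
  have q_eq: "q (\<theta> w) = - a * exp (D * (H y0 - H w))" if "w \<in> J" for w
  proof -
    have "((\<lambda>w. q (\<theta> w) * exp (D * H w)) has_real_derivative 0) (at w)" if w: "w \<in> J" for w
    proof -
      have "((\<lambda>w. exp (D * H w)) has_real_derivative exp (D * H w) * (D * (w / W T D a w))) (at w)"
        by (auto intro!: derivative_eq_intros H_has_derivative[OF w])
      from DERIV_mult[OF q\<theta>[OF w] this] show ?thesis
        using a_nonzero by (simp add: pq[OF w])
    qed
    from const[OF this that] have "q (\<theta> w) * exp (D * H w) = - a * exp (D * H y0)"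
      using init by (simp add: \<theta>0 q_def)
    then show ?thesis unfolding right_diff_distrib exp_diff by (simp add: field_simps)
  qed
  \<comment> \<open>By the formula for \<open>q\<close>, \<open>x\<close> equals
    \<open>a * (1 - exp (D * (H y0 - H w))) / D\<close>, with limiting case
    \<open>a * (H w - H y0)\<close> at \<open>D = 0\<close>; both increase with
    \<open>H w\<close>.\<close>
  have x_sign: "(x (\<theta> w) < 0 \<longleftrightarrow> H w < H y0) \<and> (x (\<theta> w) = 0 \<longleftrightarrow> H w = H y0)" if w: "w \<in> J" for w
  proof (cases "D = 0")
    case True
    have "((\<lambda>w. x (\<theta> w) - a * H w) has_real_derivative 0) (at w)" if w: "w \<in> J" for w
    proof -
      have "p (\<theta> w) = - w" using pq[OF w] q_eq[OF w] True a_nonzero by simp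
      with DERIV_diff[OF x\<theta>[OF w] DERIV_cmult[OF H_has_derivative[OF w], of a]]
      show ?thesis by simp
    qed
    from const[OF this w] have "x (\<theta> w) = a * (H w - H y0)"
      using init by (simp add: \<theta>0 right_diff_distrib)
    then show ?thesis using \<open>a > 0\<close> by (simp add: mult_less_0_iff)
  next
    case False
    define c where "c = (1 - exp (D * (H y0 - H w))) / D"
    have "x (\<theta> w) = a * c"
      using q_eq[OF w] False by (simp add: q_def c_def field_simps)
    moreover have "c < 0 \<longleftrightarrow> H w < H y0"
      using False by (auto simp: c_def divide_less_0_iff zero_less_mult_iff mult_less_0_iff)
    moreover have "c = 0 \<longleftrightarrow> H w = H y0"
      using False by (auto simp: c_def)
    ultimately show ?thesis using \<open>a > 0\<close> by (simp add: mult_less_0_iff)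
  qed
  define y1 where "y1 = phi y0"
  have y1: "y1 \<in> J" "y1 < 0" "H y1 = H y0"
    using assms by (simp_all add: y1_def phi_in_J phi_neg H_phi)
  have sub: "{y1..y0} \<subseteq> J" using interval_subset_J y1 assms by blast
  \<comment> \<open>Time decreases in \<open>w\<close>: the excursion runs through \<open>w\<close>
    from \<open>y0\<close> down to \<open>y1\<close>.\<close>
  have "\<theta> y0 < \<theta> y1"
  proof (rule DERIV_neg_imp_decreasing[where f = \<theta> and a = y1 and b = y0])
    fix w assume "y1 \<le> w" "w \<le> y0"
    then have "w \<in> J" using sub by auto
    then show "\<exists>d. (\<theta> has_real_derivative d) (at w) \<and> d < 0"
      using \<theta> W_pos \<open>a > 0\<close> by (intro exI[of _ "- (a / W T D a w)"]) auto
  qed (use y1 assms in simp)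
  then have \<tau>: "\<theta> y1 > 0" using \<theta>0 by simp
  have "x t < 0" if t: "t \<in> {0<..<\<theta> y1}" for t
  proof -
    have "isCont \<theta> w" if "y1 \<le> w" "w \<le> y0" for w
      using \<theta>[of w] sub that by (intro DERIV_isCont) auto
    then obtain w where w: "y1 \<le> w" "w \<le> y0" "\<theta> w = t"
      using IVT2[of \<theta> y0 t y1] t \<theta>0 y1 assms by auto
    then have w': "y1 < w" "w < y0" using t \<theta>0 by (auto simp: order_less_le)
    have wJ: "w \<in> J" using w sub by auto
    \<comment> \<open>Strictly between \<open>phi y0\<close> and \<open>y0\<close> the value
      \<open>h w\<close> is smaller in modulus than \<open>h y0\<close>.\<close>
    have "h w < h y0" "- h y0 < h w"
      using h_strict_mono[OF wJ assms(2) w'(2)] h_strict_mono[OF y1(1) wJ w'(1)]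
      by (simp_all add: y1_def)
    then have "(h y0 - h w) * (h y0 + h w) > 0" by (intro mult_pos_pos) auto
    then have "H w < H y0"
      using h_squared[OF wJ] h_squared[OF assms(2)] by (simp add: algebra_simps power2_eq_square)
    then show ?thesis using x_sign[OF wJ] w by simp
  qed
  moreover have "x (\<theta> y1) = 0" using x_sign[OF y1(1)] y1 by simp
  moreover have "y (\<theta> y1) = y1"
    using pq[OF y1(1)] q_eq[OF y1(1)] y1 calculation(2) a_nonzero by (simp add: p_def)
  ultimately show ?thesis
    unfolding left_return_def y1_def[symmetric] using sol init \<tau> assms(3)
    by (intro conjI, simp) (rule exI[of _ x], rule exI[of _ y], rule exI[of _ "\<theta> y1"], blast)
qed

text \<open>No return starts at \<open>y0 = 0\<close>; the value at the origin belongs to the graph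
  only through the continuous extension.\<close>

lemma left_return_iff_pos_a:
  assumes "a > 0"
  shows "left_return T D a y0 y1 \<longleftrightarrow> y0 \<in> J \<and> y0 > 0 \<and> y1 = phi y0"
proof
  assume "left_return T D a y0 y1"
  then obtain x y \<tau> where *: "is_solution T D a x y" "x 0 = 0" "y 0 = y0" "\<tau> > 0"
    "x \<tau> = 0" "\<And>t. 0 < t \<Longrightarrow> t < \<tau> \<Longrightarrow> x t < 0" "y \<tau> = y1"
    unfolding left_return_def by auto
  interpret half_map_solution T D a x y by unfold_locales (rule *)
  show "y0 \<in> J \<and> y0 > 0 \<and> y1 = phi y0"
    using left_return_pos_a[OF assms *(2,4,5,6)] phi_unique[of y0 y1] *(3,7) by auto
qed (use left_return_phi assms in blast)

lemma left_return_neg_aE: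
  assumes "a < 0" "left_return T D a y0 y1"
  obtains \<tau> where "\<tau> > 0" "D > 0" "W T D a y0 > 0" "W T D a y1 = exp (T * \<tau>) * W T D a y0"
    "a\<^sup>2 \<le> D\<^sup>2 * \<tau>\<^sup>2 * exp ((2 * \<bar>T\<bar> + \<bar>D\<bar> + 1) * \<tau>) * (y0\<^sup>2 + a\<^sup>2)"
proof -
  from assms(2) obtain x y \<tau> where *: "is_solution T D a x y" "x 0 = 0" "y 0 = y0" "\<tau> > 0"
    "x \<tau> = 0" "\<And>t. 0 < t \<Longrightarrow> t < \<tau> \<Longrightarrow> x t < 0" "y \<tau> = y1" "y0 \<ge> 0"
    unfolding left_return_def by auto
  interpret half_map_solution T D a x y by unfold_locales (rule *)
  show ?thesis
    using left_return_neg_a[OF assms(1) *(2,4,5,6)] *(3,4,7,8) that by auto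
qed

text \<open>A short return is impossible for \<open>a < 0\<close>, whereas \<open>exp (T \<tau>) = W y1 / W y0\<close> tends to \<open>1\<close> as
  \<open>y0\<close> and \<open>y1\<close> tend to \<open>0\<close>.\<close>

lemma T_0_of_small_returns:
  assumes "a < 0" and small: "\<And>\<epsilon>. \<epsilon> > 0 \<Longrightarrow> \<exists>u\<in>{0<..<\<epsilon>}. \<exists>v\<in>{-\<epsilon><..<0}. left_return T D a u v"
  shows "T = 0"
proof (rule ccontr)
  assume T: "T \<noteq> 0"
  define C where "C = 2 * \<bar>T\<bar> + \<bar>D\<bar> + 1"
  \<comment> \<open>Majorises the right-hand side of the return estimate once
    \<open>u^2 \<le> 1\<close>. Since \<open>m 0 = 0 < a^2\<close>, continuity yields a lower bound
    \<open>\<delta>\<close> for the return time.\<close>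
  define m where "m t = D\<^sup>2 * t\<^sup>2 * exp (C * t) * (1 + a\<^sup>2)" for t
  have "isCont m 0" unfolding m_def[abs_def] by (intro continuous_intros)
  moreover have "a\<^sup>2 > 0" "m 0 = 0" using a_nonzero by (simp_all add: m_def)
  ultimately obtain \<delta> where \<delta>: "\<delta> > 0" "\<And>t. \<bar>t\<bar> < \<delta> \<Longrightarrow> \<bar>m t\<bar> < a\<^sup>2"
    unfolding continuous_at_eps_delta by (metis dist_real_def diff_zero)
  have "isCont (\<lambda>y. ln (W T D a y)) 0"
    by (intro isCont_ln' isCont_W) (use a_nonzero in \<open>simp add: W_def\<close>)
  \<comment> \<open>Half of \<open>\<bar>T\<bar> * \<delta>\<close>, because both endpoints
    contribute to the difference of logarithms.\<close>
  moreover have "\<bar>T\<bar> * \<delta> / 2 > 0" using T \<delta> by simp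
  ultimately obtain \<epsilon> where \<epsilon>: "\<epsilon> > 0"
    "\<And>y. \<bar>y\<bar> < \<epsilon> \<Longrightarrow> \<bar>ln (W T D a y) - ln (W T D a 0)\<bar> < \<bar>T\<bar> * \<delta> / 2"
    unfolding continuous_at_eps_delta by (metis dist_real_def diff_zero)
  obtain u v where uv: "0 < u" "u < min \<epsilon> 1" "- min \<epsilon> 1 < v" "v < 0" "left_return T D a u v"
    using small[of "min \<epsilon> 1"] \<epsilon>(1) by auto
  obtain \<tau> where \<tau>: "\<tau> > 0" "W T D a u > 0" "W T D a v = exp (T * \<tau>) * W T D a u"
    "a\<^sup>2 \<le> D\<^sup>2 * \<tau>\<^sup>2 * exp (C * \<tau>) * (u\<^sup>2 + a\<^sup>2)"
    unfolding C_def using left_return_neg_aE[OF assms(1) uv(5)] by metis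
  have "u\<^sup>2 \<le> 1" using uv by (simp add: power_le_one)
  then have "D\<^sup>2 * \<tau>\<^sup>2 * exp (C * \<tau>) * (u\<^sup>2 + a\<^sup>2) \<le> m \<tau>"
    unfolding m_def by (intro mult_left_mono) auto
  then have "a\<^sup>2 \<le> m \<tau>" using \<tau>(4) by simp
  then have "\<not> \<bar>\<tau>\<bar> < \<delta>" using \<delta>(2)[of \<tau>] by auto
  then have "\<delta> \<le> \<tau>" using \<tau>(1) by simp
  then have "\<bar>T\<bar> * \<delta> \<le> \<bar>T * \<tau>\<bar>" using \<tau>(1) by (simp add: abs_mult mult_left_mono)
  moreover have "T * \<tau> = ln (W T D a v) - ln (W T D a u)"
    using \<tau>(2,3) by (simp add: ln_mult_pos)
  moreover have "\<bar>u\<bar> < \<epsilon>" "\<bar>v\<bar> < \<epsilon>" using uv by auto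
  ultimately show False using \<epsilon>(2)[of u] \<epsilon>(2)[of v] by linarith
qed

lemma half_map_graph_unique:
  assumes "half_map_graph T D a y0 y1" "half_map_graph T D a y0 y2"
  shows "y1 = y2"
  using assms left_return_unique unfolding half_map_graph_def by blast

lemma half_map_eqI:
  assumes "half_map_graph T D a y0 y1"
  shows "half_map T D a y0 = y1"
  unfolding half_map_def using assms half_map_graph_unique by blast

text \<open>For \<open>a > 0\<close> the hypothesis supplies the single point missing from the
  returns, the origin. For \<open>a < 0\<close> it forces a center, where \<open>W\<close> is
  positive everywhere and \<open>J\<close> is the whole line.\<close>

lemma half_map_graph_iff:
  assumes dom: "0 \<in> half_map_dom T D a" and zero: "half_map T D a 0 = 0"
  shows "half_map_graph T D a y0 y1 \<longleftrightarrow> y0 \<in> J \<and> y0 \<ge> 0 \<and> y1 = phi y0"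
proof -
  from dom have g0: "half_map_graph T D a 0 0"
    using half_map_eqI zero unfolding half_map_dom_def by force
  show ?thesis
  proof (cases "a > 0")
    case True
    note iff = left_return_iff_pos_a[OF True]
    show ?thesis
      using g0 zero_in_J unfolding half_map_graph_def iff by (cases "y0 = 0") auto
  next
    case False
    then have a: "a < 0" using a_nonzero by simp
    \<comment> \<open>Either the orbit through the origin closes up, so
      \<open>exp (T * \<tau>) = 1\<close>, or there are arbitrarily small returns.\<close>
    have T: "T = 0"
    proof (cases "left_return T D a 0 0")
      case True
      obtain \<tau> where "\<tau> > 0" "W T D a 0 > 0" "W T D a 0 = exp (T * \<tau>) * W T D a 0"
        using left_return_neg_aE[OF a True] by metis
      then show ?thesis by simp
    next
      case False
      then show ?thesis using g0 T_0_of_small_returns[OF a] unfolding half_map_graph_def by blast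
    qed
    have "\<exists>u v. left_return T D a u v"
      using g0 zero_less_one unfolding half_map_graph_def by blast
    then have D: "D > 0" using left_return_neg_aE[OF a] by metis
    have J_UNIV: "z \<in> J" for z
      using D T a by (auto simp: mem_W_component_iff W_def intro!: add_nonneg_pos)
    have lr: "left_return T D a u (phi u)" if "u \<ge> 0" for u
      using left_return_center[OF a D that] phi_T_0[OF T J_UNIV J_UNIV, of u] T by simp
    show ?thesis
    proof
      assume g: "half_map_graph T D a y0 y1"
      then have "y0 \<ge> 0" unfolding half_map_graph_def left_return_def by auto
      moreover from lr[OF this] have "half_map_graph T D a y0 (phi y0)"
        unfolding half_map_graph_def by blast
      ultimately show "y0 \<in> J \<and> y0 \<ge> 0 \<and> y1 = phi y0"
        using half_map_graph_unique[OF g] J_UNIV by blast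
    qed (use lr in \<open>auto simp: half_map_graph_def\<close>)
  qed
qed

end

section \<open>Taylor expansion\<close>

lemma hol_ext_imp_has_derivative:
  assumes "hol_ext g x"
  shows "\<exists>d. (g has_real_derivative d) (at x)"
proof -
  from assms obtain f r where f: "r > 0" "f holomorphic_on ball (of_real x) r"
    "\<And>t. \<bar>t - x\<bar> < r \<Longrightarrow> f (of_real t) = of_real (g t)"
    by (rule hol_extE) blast
  have "(f has_field_derivative deriv f (of_real x)) (at (of_real x))"
    using f(1,2) by (intro holomorphic_derivI) auto
  from has_field_derivative_Re[OF has_vector_derivative_real_field[OF this]]
  have "((\<lambda>t. Re (f (of_real t))) has_real_derivative Re (deriv f (of_real x))) (at x)" .
  moreover have ev: "\<forall>\<^sub>F t in nhds x. Re (f (of_real t)) = g t"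
    using f(1,3) unfolding eventually_nhds_metric by (intro exI[of _ r]) (auto simp: dist_real_def)
  ultimately show ?thesis using DERIV_cong_ev[OF refl ev refl] by blast
qed

text \<open>The zeros of a nonzero power series are isolated. This justifies comparing coefficients
  in the differential equation.\<close>

lemma has_fps_expansion_zero_real:
  fixes F :: "real fps"
  assumes "(\<lambda>_. 0) has_fps_expansion F"
  shows "F = 0"
proof (rule ccontr)
  assume "F \<noteq> 0"
  have ev: "\<forall>\<^sub>F t in nhds 0. eval_fps F t = 0" and "fps_conv_radius F > 0"
    using assms by (simp_all add: has_fps_expansion_def)
  then obtain r where r: "0 < r" "ereal r < fps_conv_radius F"
    by (metis ereal_dense2 ereal_less(2))
  have sums: "(\<lambda>n. fps_nth F n * (t - 0) ^ n) sums eval_fps F t" if "norm (t - 0) < r" for t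
    using sums_eval_fps[of t F] that r(2) by (metis diff_zero ereal_less_eq(3) less_imp_le order_le_less_trans)
  have at_0: "eval_fps F 0 = 0" using ev by (rule eventually_nhds_x_imp_x)
  obtain n where n: "fps_nth F n \<noteq> 0" using \<open>F \<noteq> 0\<close> by (auto simp: fps_eq_iff)
  have "n \<noteq> 0"
  proof
    assume "n = 0"
    then show False using n at_0 by (simp add: eval_fps_at_0)
  qed
  then obtain s where s: "0 < s" "\<And>z. z \<in> cball 0 s - {0} \<Longrightarrow> eval_fps F z \<noteq> 0"
    using powser_0_nonzero[OF r(1), where a = "fps_nth F" and \<xi> = 0 and f = "eval_fps F" and m = n] sums at_0 n
    by blast
  obtain e where e: "e > 0" "\<And>t. \<bar>t\<bar> < e \<Longrightarrow> eval_fps F t = 0"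
    using ev by (auto simp: eventually_nhds_metric)
  define z where "z = min s (e / 2)"
  have "0 < z" "z \<le> s" "z < e" using e s(1) by (auto simp: z_def)
  then show False using s(2)[of z] e(2)[of z] by simp
qed

lemma has_fps_expansion_unique_real:
  fixes F G :: "real fps"
  assumes "f has_fps_expansion F" "g has_fps_expansion G" "\<forall>\<^sub>F t in nhds 0. f t = g t"
  shows "F = G"
proof -
  have "(\<lambda>t. f t - g t) has_fps_expansion F - G"
    by (rule has_fps_expansion_diff[OF assms(1,2)])
  moreover have "\<forall>\<^sub>F t in nhds 0. f t - g t = 0" using assms(3) by (rule eventually_mono) simp
  ultimately have "(\<lambda>_. 0) has_fps_expansion F - G"
    unfolding has_fps_expansion_def by (auto elim: eventually_elim2)
  then show ?thesis using has_fps_expansion_zero_real by fastforce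
qed

text \<open>The remainder is \<open>t ^ n\<close> times the shifted series, which is continuous and
  hence bounded near \<open>0\<close>.\<close>

lemma has_fps_expansion_remainder:
  fixes F :: "real fps"
  assumes "f has_fps_expansion F"
  shows "(\<lambda>t. f t - (\<Sum>k<n. fps_nth F k * t ^ k)) \<in> O[at 0 within S](\<lambda>t. t ^ n)"
proof -
  define G where "G = fps_shift n F"
  have rad: "fps_conv_radius F > 0" and ev: "\<forall>\<^sub>F t in nhds 0. eval_fps F t = f t"
    using assms by (auto simp: has_fps_expansion_def)
  have "\<forall>\<^sub>F t in nhds 0. t \<in> eball 0 (fps_conv_radius F)"
    using rad by (intro eventually_nhds_in_open) (auto simp: zero_ereal_def)
  with ev have eq: "\<forall>\<^sub>F t in nhds 0. f t - (\<Sum>k<n. fps_nth F k * t ^ k) = t ^ n * eval_fps G t"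
  proof eventually_elim
    case (elim t)
    have t: "ereal (norm t) < fps_conv_radius F" using elim by simp
    have "(\<lambda>k. fps_nth F (k + n) * t ^ (k + n)) sums (f t - (\<Sum>k<n. fps_nth F k * t ^ k))"
      using sums_split_initial_segment[OF sums_eval_fps[OF t]] elim by simp
    moreover have "(\<lambda>k. t ^ n * (fps_nth G k * t ^ k)) sums (t ^ n * eval_fps G t)"
      by (intro sums_mult sums_eval_fps) (use t in \<open>simp add: G_def\<close>)
    then have "(\<lambda>k. fps_nth F (k + n) * t ^ (k + n)) sums (t ^ n * eval_fps G t)"
      by (simp add: G_def power_add algebra_simps)
    ultimately show ?case by (rule sums_unique2)
  qed
  have "isCont (eval_fps G) 0"
    using rad by (intro continuous_eval_fps) (auto simp: G_def zero_ereal_def)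
  then have "(eval_fps G \<longlongrightarrow> eval_fps G 0) (nhds 0)"
    by (simp add: isCont_def tendsto_at_iff_tendsto_nhds)
  from tendstoD[OF this zero_less_one]
  have "\<forall>\<^sub>F t in nhds 0. norm (f t - (\<Sum>k<n. fps_nth F k * t ^ k)) \<le> (\<bar>eval_fps G 0\<bar> + 1) * norm (t ^ n)"
    using eq
  proof eventually_elim
    case (elim t)
    then have "\<bar>eval_fps G t\<bar> \<le> \<bar>eval_fps G 0\<bar> + 1" by (simp add: dist_real_def)
    then have "\<bar>t ^ n\<bar> * \<bar>eval_fps G t\<bar> \<le> \<bar>t ^ n\<bar> * (\<bar>eval_fps G 0\<bar> + 1)"
      by (intro mult_left_mono) auto
    then show ?case unfolding elim(2) by (simp add: abs_mult mult.commute)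
  qed
  then show ?thesis
    by (intro bigoI[where c = "\<bar>eval_fps G 0\<bar> + 1"]) (auto simp: eventually_at_filter elim: eventually_mono)
qed

section \<open>Taylor coefficients of the involution\<close>

context half_map_params begin

text \<open>Differentiating \<open>H (phi t) = H t\<close> gives \<open>phi phi' W = t W(phi)\<close>; it is written here in terms of
  \<open>phi\<^sup>2\<close> and divided by \<open>a\<^sup>2 / 2\<close>.\<close>

lemma phi_differential_equation:
  assumes "t \<in> J"
  defines "s \<equiv> T / a" and "d \<equiv> D / a\<^sup>2" and "\<psi> \<equiv> (\<lambda>t. phi t * phi t)"
  shows "deriv \<psi> t - s * (t * deriv \<psi> t) + d * (t * (t * deriv \<psi> t))
    = 2 * (t * (1 - s * phi t + d * \<psi> t))"
proof -
  obtain c where c: "(phi has_real_derivative c) (at t)"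
    using hol_ext_imp_has_derivative[OF hol_ext_phi[OF assms(1)]] by blast
  have "((\<lambda>t. H (phi t)) has_real_derivative phi t / W T D a (phi t) * c) (at t)"
    by (rule DERIV_chain2[OF H_has_derivative[OF phi_in_J] c])
  moreover have "((\<lambda>t. H (phi t)) has_real_derivative t / W T D a t) (at t)"
  proof -
    have "\<forall>\<^sub>F u in nhds t. u \<in> J" using open_J assms(1) by (rule eventually_nhds_in_open)
    then have ev: "\<forall>\<^sub>F u in nhds t. H u = H (phi u)" by (rule eventually_mono) (simp add: H_phi)
    show ?thesis using DERIV_cong_ev[OF refl ev refl] H_has_derivative[OF assms(1)] by blast
  qed
  ultimately have "phi t / W T D a (phi t) * c = t / W T D a t" by (rule DERIV_unique)
  then have eq: "phi t * c * W T D a t = t * W T D a (phi t)"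
    using W_pos[OF assms(1)] W_pos[OF phi_in_J[of t]] by (simp add: field_simps)
  have "(\<psi> has_real_derivative 2 * (phi t * c)) (at t)"
    unfolding \<psi>_def by (auto intro!: derivative_eq_intros c)
  then have d\<psi>: "deriv \<psi> t = 2 * (phi t * c)" by (rule DERIV_imp_deriv)
  have W_sd: "W T D a u = a\<^sup>2 * (1 - s * u + d * (u * u))" for u
    using a_nonzero by (simp add: W_def s_def d_def field_simps power2_eq_square)
  have "phi t * c * (1 - s * t + d * (t * t)) = t * (1 - s * phi t + d * (phi t * phi t))"
    using eq a_nonzero unfolding W_sd by simp
  then show ?thesis unfolding d\<psi> by (simp add: \<psi>_def algebra_simps)
qed

text \<open>With \<open>G = F * F\<close> the differential equation is linear in \<open>F\<close>
  and \<open>G\<close>. The newest coefficient of \<open>F\<close> enters the next one of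
  \<open>G\<close> with factor \<open>2 * c1 = - 2\<close>, so each equation determines one more
  coefficient.\<close>

lemma phi_taylor_coefficients:
  assumes F: "phi has_fps_expansion F"
  defines "s \<equiv> T / a" and "d \<equiv> D / a\<^sup>2"
  shows "fps_nth F 0 = 0" "fps_nth F (Suc 0) = - 1" "fps_nth F 2 = - 2 * s / 3" "fps_nth F 3 = - 4 * s ^ 2 / 9"
    "fps_nth F 4 = 2 * (9 * d * s - 22 * s ^ 3) / 135"
    "fps_nth F 5 = 4 * (27 * d * s ^ 2 - 26 * s ^ 4) / 405"
    "fps_nth F 6 = - 2 * (27 * d ^ 2 * s - 176 * d * s ^ 3 + 100 * s ^ 5) / 945"
proof -
  let ?c = "fps_nth F"
  show c0: "?c 0 = 0"
    using F phi_0 eventually_nhds_x_imp_x[of "\<lambda>z. eval_fps F z = phi z" 0]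
    by (simp add: has_fps_expansion_def eval_fps_at_0)
  define G where "G = F * F"
  have \<psi>: "(\<lambda>t. phi t * phi t) has_fps_expansion G"
    unfolding G_def by (rule has_fps_expansion_mult[OF F F])
  note intros = has_fps_expansion_add has_fps_expansion_diff has_fps_expansion_cmult_left
    has_fps_expansion_mult has_fps_expansion_fps_X has_fps_expansion_1 has_fps_expansion_deriv F \<psi>
  let ?\<psi> = "\<lambda>t. phi t * phi t"
  have l: "(\<lambda>t. deriv ?\<psi> t - s * (t * deriv ?\<psi> t) + d * (t * (t * deriv ?\<psi> t))) has_fps_expansion
      fps_deriv G - fps_const s * (fps_X * fps_deriv G) + fps_const d * (fps_X * (fps_X * fps_deriv G))"
    by (intro intros)
  have r: "(\<lambda>t. 2 * (t * (1 - s * phi t + d * (phi t * phi t)))) has_fps_expansion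
      fps_const 2 * (fps_X * (1 - fps_const s * F + fps_const d * G))"
    by (intro intros)
  have "\<forall>\<^sub>F t in nhds 0. t \<in> J" using open_J zero_in_J by (rule eventually_nhds_in_open)
  then have "fps_deriv G - fps_const s * (fps_X * fps_deriv G) + fps_const d * (fps_X * (fps_X * fps_deriv G))
      = fps_const 2 * (fps_X * (1 - fps_const s * F + fps_const d * G))"
    by (intro has_fps_expansion_unique_real[OF l r])
       (auto elim!: eventually_mono simp: phi_differential_equation[folded s_def d_def])
  then have nth: "fps_nth (fps_deriv G - fps_const s * (fps_X * fps_deriv G) + fps_const d * (fps_X * (fps_X * fps_deriv G))) n
      = fps_nth (fps_const 2 * (fps_X * (1 - fps_const s * F + fps_const d * G))) n" for n by simp
  have G0: "fps_nth G 0 = 0" by (simp add: G_def c0)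
  have G: "fps_nth G 1 = 0" "fps_nth G 2 = ?c 1 ^ 2" "fps_nth G 3 = 2 * ?c 1 * ?c 2"
    "fps_nth G 4 = 2 * ?c 1 * ?c 3 + ?c 2 ^ 2" "fps_nth G 5 = 2 * ?c 1 * ?c 4 + 2 * ?c 2 * ?c 3"
    "fps_nth G 6 = 2 * ?c 1 * ?c 5 + 2 * ?c 2 * ?c 4 + ?c 3 ^ 2"
    "fps_nth G 7 = 2 * ?c 1 * ?c 6 + 2 * ?c 2 * ?c 5 + 2 * ?c 3 * ?c 4"
    unfolding G_def by (simp_all add: fps_mult_nth eval_nat_numeral c0)
  have e1: "2 * fps_nth G 2 = 2"
    using nth[of 1] G0 G(1) c0 by (simp add: numeral_2_eq_2)
  \<comment> \<open>The coefficient of \<open>X ^ (n + 2)\<close>; the coefficient of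
    \<open>X\<close> is separate in \<open>e1\<close> because the constant \<open>1\<close>
    contributes there.\<close>
  have e: "real (n + 3) * fps_nth G (n + 3) - s * (real (n + 2) * fps_nth G (n + 2)) + d * (real (n + 1) * fps_nth G (n + 1))
      = 2 * (d * fps_nth G (n + 1) - s * ?c (n + 1))" for n
    using nth[of "n + 2"] by (simp add: numeral_2_eq_2 numeral_3_eq_3)
  have e2: "3 * fps_nth G 3 - s * (2 * fps_nth G 2) + d * fps_nth G 1 = 2 * (d * fps_nth G 1 - s * ?c 1)"
    using e[of 0] by (simp add: eval_nat_numeral)
  have e3: "4 * fps_nth G 4 - s * (3 * fps_nth G 3) + d * (2 * fps_nth G 2) = 2 * (d * fps_nth G 2 - s * ?c 2)"
    using e[of 1] by (simp add: eval_nat_numeral)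
  have e4: "5 * fps_nth G 5 - s * (4 * fps_nth G 4) + d * (3 * fps_nth G 3) = 2 * (d * fps_nth G 3 - s * ?c 3)"
    using e[of 2] by (simp add: eval_nat_numeral)
  have e5: "6 * fps_nth G 6 - s * (5 * fps_nth G 5) + d * (4 * fps_nth G 4) = 2 * (d * fps_nth G 4 - s * ?c 4)"
    using e[of 3] by (simp add: eval_nat_numeral)
  have e6: "7 * fps_nth G 7 - s * (6 * fps_nth G 6) + d * (5 * fps_nth G 5) = 2 * (d * fps_nth G 5 - s * ?c 5)"
    using e[of 4] by (simp add: eval_nat_numeral)
  have "?c 1 ^ 2 = 1" using e1 G(2) by simp
  \<comment> \<open>The identity solves the same differential equation; it is excluded because
    \<open>phi\<close> is negative to the right of \<open>0\<close>.\<close>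
  moreover have "?c 1 \<noteq> 1"
  proof
    assume c1: "?c 1 = 1"
    obtain c where c: "(phi has_real_derivative c) (at 0)"
      using hol_ext_imp_has_derivative[OF hol_ext_phi[OF zero_in_J]] by blast
    have "deriv phi 0 = fps_nth (fps_deriv F) 0"
      using has_fps_expansion_deriv[OF F] eventually_nhds_x_imp_x[of "\<lambda>z. eval_fps (fps_deriv F) z = deriv phi z" 0]
      by (simp add: has_fps_expansion_def eval_fps_at_0)
    then have "c > 0" using DERIV_imp_deriv[OF c] c1 by simp
    from DERIV_pos_inc_right[OF c this] obtain e where
      e: "e > 0" "\<And>h. 0 < h \<Longrightarrow> h < e \<Longrightarrow> phi 0 < phi (0 + h)" by blast
    obtain e' where e': "e' > 0" "ball 0 e' \<subseteq> J" using open_J zero_in_J openE by blast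
    define z where "z = min e e' / 2"
    have z: "0 < z" "z < e" "z < e'" using e(1) e'(1) by (auto simp: z_def)
    then have "z \<in> J" using e' by (auto simp: subset_iff)
    then have "phi z < 0" using z by (intro phi_neg)
    then show False using e(2)[of z] z by simp
  qed
  ultimately have c1: "?c 1 = - 1" by (simp add: power2_eq_1_iff)
  then show "?c (Suc 0) = - 1" by simp
  have G1: "fps_nth G 2 = 1" using G(2) c1 by simp
  show c2: "?c 2 = - 2 * s / 3" using e2 G(1,3) G1 c1 by simp
  have G3: "fps_nth G 3 = 4 * s / 3" using G(3) c1 c2 by simp
  show c3: "?c 3 = - 4 * s ^ 2 / 9"
    using e3 unfolding G(4) G3 G1 c1 c2 by (simp add: field_simps power2_eq_square)
  have G4: "fps_nth G 4 = 4 * s ^ 2 / 3" unfolding G(4) c1 c2 c3 by (simp add: field_simps power2_eq_square)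
  show c4: "?c 4 = 2 * (9 * d * s - 22 * s ^ 3) / 135"
    using e4 unfolding G(5) G4 G3 c1 c2 c3 by (simp add: field_simps eval_nat_numeral)
  have G5: "fps_nth G 5 = (- 36 * d * s + 168 * s ^ 3) / 135"
    unfolding G(5) c1 c2 c3 c4 by (simp add: field_simps eval_nat_numeral)
  show c5: "?c 5 = 4 * (27 * d * s ^ 2 - 26 * s ^ 4) / 405"
    using e5 unfolding G(6) G5 G4 c1 c2 c3 c4 by (simp add: field_simps eval_nat_numeral)
  have G6: "fps_nth G 6 = - 2 * ?c 5 + 2 * ?c 2 * ?c 4 + ?c 3 ^ 2"
    unfolding G(6) c1 by simp
  show "?c 6 = - 2 * (27 * d ^ 2 * s - 176 * d * s ^ 3 + 100 * s ^ 5) / 945"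
    using e6 unfolding G(7) G6 G5 c1 c2 c3 c4 c5 by (simp add: field_simps eval_nat_numeral)
qed

end

section \<open>Transfer to the half-map\<close>

context half_map_params begin

text \<open>The open set \<open>J\<close> and the function \<open>phi\<close> serve at every point,
  including the endpoint \<open>0\<close> of the half-map domain, which is interior to
  \<open>J\<close>.\<close>

lemma real_analytic_on_phi:
  assumes "S \<subseteq> J" "\<And>y. y \<in> S \<Longrightarrow> f y = phi y"
  shows "real_analytic_on f S"
  unfolding real_analytic_on_def
proof (intro ballI exI conjI)
  show "open J" by (rule open_J)
qed (use assms hol_ext_phi hol_ext_imp_real_analytic_at in auto)

lemma zero_set_integral:
  assumes "y1 \<in> J" "y0 \<in> J"
  shows "(LBINT y=ereal y1..ereal y0. - y / W T D a y) = 0 \<longleftrightarrow> (y1 - y0) * (y1 - phi y0) = 0"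
  using interval_integral_eq_H_diff[OF assms] H_eq_iff[OF assms] by auto

lemma phi_taylor:
  "(\<lambda>y. phi y -
     (- y - 2 * T * y ^ 2 / (3 * a) - 4 * T ^ 2 * y ^ 3 / (9 * a ^ 2)
      + 2 * (9 * D * T - 22 * T ^ 3) * y ^ 4 / (135 * a ^ 3)
      + 4 * (27 * D * T ^ 2 - 26 * T ^ 4) * y ^ 5 / (405 * a ^ 4)
      - 2 * (27 * D ^ 2 * T - 176 * D * T ^ 3 + 100 * T ^ 5) * y ^ 6 / (945 * a ^ 5)))
    \<in> O[at 0 within S](\<lambda>y. y ^ 7)"
proof -
  obtain F where F: "phi has_fps_expansion F"
    using hol_ext_imp_real_analytic_at[OF hol_ext_phi[OF zero_in_J]] by (auto simp: real_analytic_at_def)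
  note c = phi_taylor_coefficients[OF F]
  have c2: "- 2 * (T / a) / 3 = - (2 * T / (3 * a))"
    and c3: "- 4 * (T / a)\<^sup>2 / 9 = - (4 * T ^ 2 / (9 * a ^ 2))"
    and c4: "2 * (9 * (D / a\<^sup>2) * (T / a) - 22 * (T / a) ^ 3) / 135 = 2 * (9 * D * T - 22 * T ^ 3) / (135 * a ^ 3)"
    and c5: "4 * (27 * (D / a\<^sup>2) * (T / a)\<^sup>2 - 26 * (T / a) ^ 4) / 405 = 4 * (27 * D * T ^ 2 - 26 * T ^ 4) / (405 * a ^ 4)"
    and c6: "- 2 * (27 * (D / a\<^sup>2)\<^sup>2 * (T / a) - 176 * (D / a\<^sup>2) * (T / a) ^ 3 + 100 * (T / a) ^ 5) / 945
      = - (2 * (27 * D ^ 2 * T - 176 * D * T ^ 3 + 100 * T ^ 5) / (945 * a ^ 5))"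
    using a_nonzero by (simp_all add: field_simps eval_nat_numeral)
  have "(\<Sum>k<7. fps_nth F k * y ^ k)
    = fps_nth F 0 + fps_nth F (Suc 0) * y + fps_nth F 2 * y ^ 2 + fps_nth F 3 * y ^ 3
      + fps_nth F 4 * y ^ 4 + fps_nth F 5 * y ^ 5 + fps_nth F 6 * y ^ 6" for y
    by (simp add: eval_nat_numeral)
  also have "\<dots> y = - y - 2 * T * y ^ 2 / (3 * a) - 4 * T ^ 2 * y ^ 3 / (9 * a ^ 2)
      + 2 * (9 * D * T - 22 * T ^ 3) * y ^ 4 / (135 * a ^ 3)
      + 4 * (27 * D * T ^ 2 - 26 * T ^ 4) * y ^ 5 / (405 * a ^ 4)
      - 2 * (27 * D ^ 2 * T - 176 * D * T ^ 3 + 100 * T ^ 5) * y ^ 6 / (945 * a ^ 5)" for y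
    unfolding c c2 c3 c4 c5 c6 by simp
  finally show ?thesis using has_fps_expansion_remainder[OF F, of 7 S] by simp
qed

end

theorem proposition1:
  fixes T D a :: real
  assumes "a \<noteq> 0"
    and "0 \<in> half_map_dom T D a"
    and "half_map T D a 0 = 0"
  shows "real_analytic_on (half_map T D a) (half_map_dom T D a) \<and>
    half_map_involution T D a \<and>
    (\<lambda>y0. half_map T D a y0 -
       (- y0 - 2 * T * y0 ^ 2 / (3 * a) - 4 * T ^ 2 * y0 ^ 3 / (9 * a ^ 2)
        + 2 * (9 * D * T - 22 * T ^ 3) * y0 ^ 4 / (135 * a ^ 3)
        + 4 * (27 * D * T ^ 2 - 26 * T ^ 4) * y0 ^ 5 / (405 * a ^ 4)
        - 2 * (27 * D ^ 2 * T - 176 * D * T ^ 3 + 100 * T ^ 5) * y0 ^ 6 / (945 * a ^ 5)))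
      \<in> O[at 0 within half_map_dom T D a](\<lambda>y0. y0 ^ 7)"
proof -
  interpret half_map_params T D a by unfold_locales fact
  note graph_iff = half_map_graph_iff[OF assms(2,3)]
  have dom: "half_map_dom T D a = J \<inter> {0..}"
    unfolding half_map_dom_def by (auto simp: graph_iff)
  have eq: "half_map T D a y = phi y" if "y \<in> half_map_dom T D a" for y
    using that unfolding dom by (intro half_map_eqI) (simp add: graph_iff)
  have "real_analytic_on (half_map T D a) (half_map_dom T D a)"
    using dom eq by (intro real_analytic_on_phi) auto
  moreover have "half_map_involution T D a"
    unfolding half_map_involution_def Let_def
  proof (intro exI[of _ phi] conjI)
    show "real_analytic_on phi J" by (rule real_analytic_on_phi) auto
    show "{(y1, y0). y1 \<in> J \<and> y0 \<in> J \<and> (LBINT y=ereal y1..ereal y0. - y / W T D a y) = 0} =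
        {(y1, y0). y1 \<in> J \<and> y0 \<in> J \<and> (y1 - y0) * (y1 - phi y0) = 0}"
      using zero_set_integral by blast
  qed (use phi_in_J phi_phi dom eq in auto)
  \<comment> \<open>The values of \<open>half_map\<close> matter only on its domain, which is why
    the expansion is taken along the filter within it.\<close>
  moreover have "\<forall>\<^sub>F y in at 0 within half_map_dom T D a. half_map T D a y = phi y"
    by (auto simp: eventually_at_filter eq)
  then have bigo_iff: "(\<lambda>y. half_map T D a y - p y) \<in> O[at 0 within half_map_dom T D a](\<lambda>y. y ^ 7) \<longleftrightarrow>
      (\<lambda>y. phi y - p y) \<in> O[at 0 within half_map_dom T D a](\<lambda>y. y ^ 7)" for p
    by (intro landau_o.big.in_cong) (auto elim: eventually_mono)
  ultimately show ?thesis by (intro conjI iffD2[OF bigo_iff] phi_taylor)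
qed

end
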